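(* Let $k\ge1$ and let $(H,\psi)$ be a rainbow pre-coloring tuple with colors in $[k]$. Then the limit $\pi_k^{\ast}(H, \psi)=\lim_{n\to\infty}\mathrm{ex}_k^{\ast}(n,H,\psi)/\binom{n}{2}$ exists and $$\pi_k^{\ast}(H, \psi) = \sup_{\mathbf{W}:\ t^{*}_{(H, \psi)}(\mathbf{W})=0}\ \min_{1 \leq \ell \leq k} t_{K_2}(W_\ell),$$ where the supremum is taken over all admissible graphon systems $\mathbf{W}$ of order $k$ with $t^{*}_{(H, \psi)}(\mathbf{W})=0$, and $t_{K_2}(W)=\int_{[0,1]^2}W(x,y)\,dx\,dy$.
   Context: Multigraphs have no loops. For a multigraph $H$ and distinct $u,v$, $E_{uv}$ is the set of edges between $u$ and $v$. A rainbow pre-coloring of $H$ is an injective map $\psi:X\to[k]$ with $X\subseteq E(H)$. A graph system of order $k$ on $V$ is a tuple of simple graphs $(G_1,\dots,G_k)$ on $V$; it is rainbow $(H,\psi)$-free if there is no multigraph $H'$ with $V(H')\subseteq V$, isomorphism $\phi:H\to H'$ and injective $\psi':E(H')\to[k]$ with $\psi'\circ\phi$ extending $\psi$ and $e\in E(G_{\psi'(e)})$ for all $e\in E(H')$. $\mathrm{ex}_k^*(n,H,\psi)$ is the maximum of $\min_i|E(G_i)|$ over rainbow $(H,\psi)$-free graph systems of order $k$ on $[n]$. A graphon is a symmetric measurable $W:[0,1]^2\to[0,1]$; a graphon system of order $k$ is $(W_I)_{I\subseteq[k]}$ with $W_\emptyset\equiv1$, and $W_\ell=W_{\{\ell\}}$.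 Define $\overline{W}_{[k]}=W_{[k]}$, $\overline{W}_I=W_I-\sum_{J\supsetneq I}\overline{W}_J$; $\mathbf{W}$ is admissible if all $\overline W_I\ge0$ a.e. For a coloring $\tilde\psi:E(H)\to[k]$, $t^*_{(H,\tilde\psi)}(\mathbf{W})=\int_{[0,1]^{V(H)}}\prod_{\{u,v\}\subseteq V(H),u\neq v}W_{\tilde\psi(E_{uv})}(x_u,x_v)\prod_v dx_v$; if $\mathbf{dom}(\psi)\subsetneq E(H)$, $t^*_{(H,\psi)}(\mathbf{W})=\sum_{\tilde\psi}t^*_{(H,\tilde\psi)}(\mathbf{W})$ over injective $\tilde\psi:E(H)\to[k]$ extending $\psi$. *)

theory Defs
  imports "HOL-Analysis.Analysis"
begin

section \<open>Multigraphs and rainbow pre-colorings\<close>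

record ('v, 'e) multigraph =
  verts :: "'v set"
  edges :: "'e set"
  ends :: "'e \<Rightarrow> 'v set"

text \<open>Multigraphs are finite; parallel edges are distinct elements of the edge type with the same
  ends, and a loop is excluded because every edge has exactly two ends.\<close>

definition loopless_multigraph :: "('v, 'e) multigraph \<Rightarrow> bool" where
  "loopless_multigraph H \<longleftrightarrow>
     finite (verts H) \<and> finite (edges H) \<and>
     (\<forall>e\<in>edges H. ends H e \<subseteq> verts H \<and> card (ends H e) = 2)"

definition multigraph_iso ::
    "('v, 'e) multigraph \<Rightarrow> ('w, 'f) multigraph \<Rightarrow> ('v \<Rightarrow> 'w) \<Rightarrow> ('e \<Rightarrow> 'f) \<Rightarrow> bool" where
  "multigraph_iso H H' \<phi>V \<phi>E \<longleftrightarrow>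
     bij_betw \<phi>V (verts H) (verts H') \<and> bij_betw \<phi>E (edges H) (edges H') \<and>
     (\<forall>e\<in>edges H. ends H' (\<phi>E e) = \<phi>V ` ends H e)"

definition rainbow_precoloring :: "nat \<Rightarrow> ('v, 'e) multigraph \<Rightarrow> ('e \<rightharpoonup> nat) \<Rightarrow> bool" where
  "rainbow_precoloring k H \<psi> \<longleftrightarrow>
     dom \<psi> \<subseteq> edges H \<and> ran \<psi> \<subseteq> {1..k} \<and> inj_on \<psi> (dom \<psi>)"

definition extends :: "('e \<Rightarrow> nat) \<Rightarrow> ('e \<rightharpoonup> nat) \<Rightarrow> bool" where
  "extends \<rho> \<psi> \<longleftrightarrow> (\<forall>e c. \<psi> e = Some c \<longrightarrow> \<rho> e = c)"

section \<open>Graph systems and the extremal number\<close>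

text \<open>A simple graph on \<open>V\<close> is given by its edge set, a set of two-element subsets of \<open>V\<close>.\<close>

definition graph_system :: "nat \<Rightarrow> 'a set \<Rightarrow> (nat \<Rightarrow> 'a set set) \<Rightarrow> bool" where
  "graph_system k V G \<longleftrightarrow> (\<forall>i\<in>{1..k}. \<forall>e\<in>G i. e \<subseteq> V \<and> card e = 2)"

text \<open>The copy \<open>H'\<close> uses the edge type of \<open>H\<close>; this is no restriction, since the edge sets of
  \<open>H\<close> and \<open>H'\<close> are in bijection.\<close>

definition rainbow_free ::
    "nat \<Rightarrow> 'a set \<Rightarrow> (nat \<Rightarrow> 'a set set) \<Rightarrow> ('v, 'e) multigraph \<Rightarrow> ('e \<rightharpoonup> nat) \<Rightarrow> bool" where
  "rainbow_free k V G H \<psi> \<longleftrightarrow>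
     \<not> (\<exists>(H' :: ('a, 'e) multigraph) \<phi>V \<phi>E \<psi>'.
          loopless_multigraph H' \<and> verts H' \<subseteq> V \<and>
          multigraph_iso H H' \<phi>V \<phi>E \<and>
          \<psi>' ` edges H' \<subseteq> {1..k} \<and> inj_on \<psi>' (edges H') \<and>
          extends (\<psi>' \<circ> \<phi>E) \<psi> \<and>
          (\<forall>e\<in>edges H'. ends H' e \<in> G (\<psi>' e)))"

text \<open>For \<open>k \<ge> 1\<close> the set below is bounded, so \<open>Sup\<close> on \<open>nat\<close> is its maximum. It is empty only if
  \<open>H\<close> has no edges (and at most \<open>n\<close> vertices); then \<open>Sup {} = 0\<close>.\<close>

definition ex_star :: "nat \<Rightarrow> nat \<Rightarrow> ('v, 'e) multigraph \<Rightarrow> ('e \<rightharpoonup> nat) \<Rightarrow> nat" where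
  "ex_star k n H \<psi> =
     Sup {Min ((\<lambda>i. card (G i)) ` {1..k}) | G.
            graph_system k {1..n} G \<and> rainbow_free k {1..n} G H \<psi>}"

definition ex_density :: "nat \<Rightarrow> ('v, 'e) multigraph \<Rightarrow> ('e \<rightharpoonup> nat) \<Rightarrow> nat \<Rightarrow> real" where
  "ex_density k H \<psi> n = real (ex_star k n H \<psi>) / real (n choose 2)"

definition pi_star :: "nat \<Rightarrow> ('v, 'e) multigraph \<Rightarrow> ('e \<rightharpoonup> nat) \<Rightarrow> real" where
  "pi_star k H \<psi> = lim (ex_density k H \<psi>)"

section \<open>Graphon systems\<close>

definition unit_measure :: "real measure" where
  "unit_measure = restrict_space lborel {0..1}"

text \<open>Measurability is Borel measurability, and only the values on the unit square matter.\<close>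

definition graphon :: "(real \<times> real \<Rightarrow> real) \<Rightarrow> bool" where
  "graphon W \<longleftrightarrow>
     W \<in> borel_measurable (unit_measure \<Otimes>\<^sub>M unit_measure) \<and>
     (\<forall>x\<in>{0..1}. \<forall>y\<in>{0..1}. W (x, y) = W (y, x) \<and> W (x, y) \<in> {0..1})"

definition graphon_system :: "nat \<Rightarrow> (nat set \<Rightarrow> real \<times> real \<Rightarrow> real) \<Rightarrow> bool" where
  "graphon_system k W \<longleftrightarrow>
     (\<forall>I. I \<subseteq> {1..k} \<longrightarrow> graphon (W I)) \<and> (\<forall>z\<in>{0..1} \<times> {0..1}. W {} z = 1)"

function overline_system ::
    "nat \<Rightarrow> (nat set \<Rightarrow> real \<times> real \<Rightarrow> real) \<Rightarrow> nat set \<Rightarrow> real \<times> real \<Rightarrow> real" where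
  "overline_system k W I z =
     W I z - (\<Sum>J\<in>{J. I \<subset> J \<and> J \<subseteq> {1..k}}. overline_system k W J z)"
  by pat_completeness auto
termination
proof (relation "Wellfounded.measure (\<lambda>(k, W, I, z). card ({1..k} - I))")
  fix k :: nat and W :: "nat set \<Rightarrow> real \<times> real \<Rightarrow> real" and I J :: "nat set"
    and z :: "real \<times> real"
  assume "J \<in> {J. I \<subset> J \<and> J \<subseteq> {1..k}}"
  then have "{1..k} - J \<subset> {1..k} - I" by blast
  then show "((k, W, J, z), k, W, I, z) \<in> Wellfounded.measure (\<lambda>(k, W, I, z). card ({1..k} - I))"
    by (simp add: psubset_card_mono)
qed simp

declare overline_system.simps [simp del]

definition admissible :: "nat \<Rightarrow> (nat set \<Rightarrow> real \<times> real \<Rightarrow> real) \<Rightarrow> bool" where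
  "admissible k W \<longleftrightarrow>
     graphon_system k W \<and>
     (\<forall>I. I \<subseteq> {1..k} \<longrightarrow> (AE z in unit_measure \<Otimes>\<^sub>M unit_measure. 0 \<le> overline_system k W I z))"

section \<open>Densities\<close>

definition t_K2 :: "(real \<times> real \<Rightarrow> real) \<Rightarrow> real" where
  "t_K2 W = (\<integral>z. W z \<partial>(unit_measure \<Otimes>\<^sub>M unit_measure))"

text \<open>The common value of \<open>W (x u, x v)\<close> and \<open>W (x v, x u)\<close> for the unordered pair \<open>p = {u, v}\<close>,
  well defined for symmetric \<open>W\<close>.\<close>

definition pair_value :: "(real \<times> real \<Rightarrow> real) \<Rightarrow> ('v \<Rightarrow> real) \<Rightarrow> 'v set \<Rightarrow> real" where
  "pair_value W x p = (THE r. \<exists>u v. p = {u, v} \<and> r = W (x u, x v))"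

text \<open>The product runs over all unordered pairs \<open>p = {u, v}\<close> of distinct vertices; the edges
  between \<open>u\<close> and \<open>v\<close> are those with \<open>ends H e = p\<close>. Pairs without edges contribute \<open>W {} = 1\<close>.\<close>

definition t_coloring ::
    "('v, 'e) multigraph \<Rightarrow> ('e \<Rightarrow> nat) \<Rightarrow> (nat set \<Rightarrow> real \<times> real \<Rightarrow> real) \<Rightarrow> real" where
  "t_coloring H \<rho> W =
     (\<integral>x. (\<Prod>p\<in>{p. p \<subseteq> verts H \<and> card p = 2}.
              pair_value (W (\<rho> ` {e \<in> edges H. ends H e = p})) x p)
        \<partial>(\<Pi>\<^sub>M v\<in>verts H. unit_measure))"

text \<open>The colorings are extensional (\<open>undefined\<close> off the edge set), so each coloring of the edges
  is counted once. If \<open>\<psi>\<close> colors all edges, the sum has the single term given by \<open>\<psi>\<close> itself.\<close>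

definition t_star ::
    "nat \<Rightarrow> ('v, 'e) multigraph \<Rightarrow> ('e \<rightharpoonup> nat) \<Rightarrow> (nat set \<Rightarrow> real \<times> real \<Rightarrow> real) \<Rightarrow> real" where
  "t_star k H \<psi> W =
     (\<Sum>\<rho>\<in>{\<rho> \<in> edges H \<rightarrow>\<^sub>E {1..k}. inj_on \<rho> (edges H) \<and> extends \<rho> \<psi>}. t_coloring H \<rho> W)"

end

theory Submission
  imports Defs "HOL-Probability.Probability"
begin

text \<open>Let \<open>s\<close> be the supremum. For \<open>\<pi>* \<ge> s\<close>, sample \<open>n\<close> points from an admissible \<open>W\<close> with
  \<open>t* = 0\<close> and give each pair of them a colour set \<open>I\<close> on which the overlined weight is positive.
  Almost surely every such choice is rainbow-free, because a copy of \<open>H\<close> would make the integrand of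
  \<open>t*\<close> positive. A second moment bound for the points and a deterministic rounding of the colour
  sets keep all \<open>k\<close> edge counts near their means.

  For \<open>\<pi>* \<le> s\<close>, suppose that a rainbow-free system on \<open>n\<close> vertices has all densities above
  \<open>s + \<epsilon>\<close>. Most samples of a bounded number \<open>m\<close> of its vertices have all densities above \<open>s\<close>.
  The step graphons of such a sample have \<open>t* > 0\<close>, so there is a homomorphism from \<open>H\<close>, which may
  identify vertices. By pigeonhole one pattern of identification has positive density, and
  Cauchy-Schwarz, applied once per vertex of \<open>H\<close>, removes the identifications. Positively many maps
  are then homomorphisms, and for large \<open>n\<close> one of them is injective.\<close>

text \<open>Both inequalities are proved for all large \<open>n\<close> against the same number
  \<open>s\<close>, so the limit exists by squeezing rather than by monotonicity of the densities.
  For the upper bound no limit object of large systems is formed: the step graphon of a bounded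
  sample already competes in the supremum. The price is that the sample and the map of
  \<open>H\<close> into it may both repeat vertices. The number of identification patterns depends
  on \<open>m\<close>, \<open>k\<close> and \<open>H\<close> only, so the pigeonhole share does not
  shrink with \<open>n\<close>. Each Cauchy-Schwarz step squares that share, while maps with a
  coincidence are a share of order \<open>1 / n\<close> and lose in the end. For the lower bound,
  putting colour \<open>l\<close> on every pair with positive \<open>W {l}\<close> would be wrong:
  parallel edges of \<open>H\<close> need several colours on one pair, and \<open>W I\<close> may
  vanish although each of its single colours has positive weight. Hence a whole colour set is chosen
  per pair, with the overlined weights, which sum to 1 because \<open>W {}\<close> is 1. Rounding
  these weights deterministically confines the randomness to the points, and freeness then holds for
  every choice of positive weight at once.\<close>

section \<open>Rounding colour weights\<close>

text \<open>A colour set drawn with weights \<open>w\<close> raises the squared deviation by at most \<open>card K\<close> in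
  expectation, so some colour set of positive weight does so.\<close>

lemma rounding_step:
  fixes w :: "'c set \<Rightarrow> real" and S :: "'c \<Rightarrow> real"
  assumes K: "finite K" and w0: "\<And>I. I \<subseteq> K \<Longrightarrow> 0 \<le> w I" and w1: "(\<Sum>I\<in>Pow K. w I) = 1"
  defines "mu \<equiv> \<lambda>l. \<Sum>I\<in>{I\<in>Pow K. l \<in> I}. w I"
  shows "\<exists>I\<subseteq>K. 0 < w I \<and>
    (\<Sum>l\<in>K. (S l + (of_bool (l \<in> I) - mu l))\<^sup>2) \<le> (\<Sum>l\<in>K. (S l)\<^sup>2) + card K"
proof (rule ccontr)
  assume neg: "\<not> ?thesis"
  define F where "F I = (\<Sum>l\<in>K. (S l + (of_bool (l \<in> I) - mu l))\<^sup>2)" for I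
  define B where "B = (\<Sum>l\<in>K. (S l)\<^sup>2) + card K"
  have fin: "finite (Pow K)" using K by simp
  have mu_eq: "mu l = (\<Sum>I\<in>Pow K. w I * of_bool (l \<in> I))" for l
    unfolding mu_def sum.inter_filter[OF fin] by (intro sum.cong) auto
  have mu0: "0 \<le> mu l" for l unfolding mu_def by (rule sum_nonneg) (use w0 in auto)
  have "mu l \<le> (\<Sum>I\<in>Pow K. w I)" for l
    unfolding mu_eq by (rule sum_mono) (use w0 in auto)
  then have mu1: "mu l \<le> 1" for l using w1 by simp
  have large: "B < F I" if "I \<subseteq> K" "0 < w I" for I
    using neg that unfolding F_def B_def by force
  have "(\<Sum>I\<in>Pow K. w I * F I) = (\<Sum>l\<in>K. \<Sum>I\<in>Pow K. w I * (S l + (of_bool (l \<in> I) - mu l))\<^sup>2)"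
    unfolding F_def sum_distrib_left by (rule sum.swap)
  also have "\<dots> \<le> (\<Sum>l\<in>K. (S l)\<^sup>2 + 1)"
  proof (rule sum_mono)
    fix l assume "l \<in> K"
    have "(\<Sum>I\<in>Pow K. w I * (S l + (of_bool (l \<in> I) - mu l))\<^sup>2)
        = (\<Sum>I\<in>Pow K. w I * (S l - mu l)\<^sup>2 + (w I * of_bool (l \<in> I)) * (1 + 2 * (S l - mu l)))"
      by (rule sum.cong) (auto simp: power2_eq_square algebra_simps of_bool_def)
    also have "\<dots> = (S l - mu l)\<^sup>2 + mu l * (1 + 2 * (S l - mu l))"
      unfolding sum.distrib sum_distrib_right[symmetric] mu_eq[symmetric] w1 by simp
    \<comment> \<open>The increment has mean zero under the weights, so its cross term with
      \<open>S l\<close> vanishes and only a Bernoulli variance remains.\<close>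
    also have "\<dots> = (S l)\<^sup>2 + (mu l - (mu l)\<^sup>2)"
      by (simp add: power2_eq_square algebra_simps)
    also have "\<dots> \<le> (S l)\<^sup>2 + 1"
      using mu1[of l] by (simp add: add_increasing2 le_diff_eq diff_le_eq)
    finally show "(\<Sum>I\<in>Pow K. w I * (S l + (of_bool (l \<in> I) - mu l))\<^sup>2) \<le> (S l)\<^sup>2 + 1" .
  qed
  also have "\<dots> = B" by (simp add: sum.distrib B_def)
  finally have le: "(\<Sum>I\<in>Pow K. w I * F I) \<le> B" .
  have "\<exists>I\<in>Pow K. 0 < w I"
  proof (rule ccontr)
    assume "\<not> ?thesis"
    then have "(\<Sum>I\<in>Pow K. w I) \<le> 0" by (intro sum_nonpos) (force simp: not_less)
    then show False using w1 by simp
  qed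
  then obtain I0 where I0: "I0 \<in> Pow K" "0 < w I0" by auto
  \<comment> \<open>A weighted mean of values above \<open>B\<close> exceeds \<open>B\<close>;
    strictness comes from one set of positive weight, \<open>I0\<close>.\<close>
  have "(\<Sum>I\<in>Pow K. w I * B) < (\<Sum>I\<in>Pow K. w I * F I)"
  proof (rule sum_strict_mono_ex1[OF fin])
    show "\<forall>I\<in>Pow K. w I * B \<le> w I * F I"
      using w0 large by (metis PowD mult_left_mono less_imp_le mult_zero_left order_le_less)
    show "\<exists>I\<in>Pow K. w I * B < w I * F I" using I0 large[of I0] by (intro bexI[of _ I0]) auto
  qed
  then show False using le w1 by (simp add: sum_distrib_right[symmetric])
qed

text \<open>The pairs are treated one after another, as in the method of conditional expectations.
  Each step adds at most \<open>card K\<close> to the total squared deviation, so every colour is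
  off by at most the square root of \<open>card K * card P\<close>, which is negligible against a
  large \<open>card P\<close>.\<close>

lemma simultaneous_rounding:
  fixes q :: "'p \<Rightarrow> 'c set \<Rightarrow> real"
  assumes K: "finite K" and "finite P"
    and "\<And>p I. p \<in> P \<Longrightarrow> I \<subseteq> K \<Longrightarrow> 0 \<le> q p I"
    and "\<And>p. p \<in> P \<Longrightarrow> (\<Sum>I\<in>Pow K. q p I) = 1"
  shows "\<exists>c. (\<forall>p\<in>P. c p \<subseteq> K \<and> 0 < q p (c p)) \<and>
    (\<Sum>l\<in>K. (\<Sum>p\<in>P. of_bool (l \<in> c p) - (\<Sum>I\<in>{I\<in>Pow K. l \<in> I}. q p I))\<^sup>2) \<le> real (card K * card P)"
  using assms(2-4)
proof (induction P rule: finite_induct)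
  case empty
  then show ?case by simp
next
  case (insert p P)
  define mu where "mu p l = (\<Sum>I\<in>{I\<in>Pow K. l \<in> I}. q p I)" for p l
  obtain c where c: "\<forall>p\<in>P. c p \<subseteq> K \<and> 0 < q p (c p)"
    and cb: "(\<Sum>l\<in>K. (\<Sum>p\<in>P. of_bool (l \<in> c p) - mu p l)\<^sup>2) \<le> real (card K * card P)"
    using insert.IH insert.prems unfolding mu_def by auto
  obtain I where I: "I \<subseteq> K" "0 < q p I"
    and Ib: "(\<Sum>l\<in>K. ((\<Sum>p\<in>P. of_bool (l \<in> c p) - mu p l) + (of_bool (l \<in> I) - mu p l))\<^sup>2)
      \<le> (\<Sum>l\<in>K. (\<Sum>p\<in>P. of_bool (l \<in> c p) - mu p l)\<^sup>2) + card K"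
    using rounding_step[OF K, of "q p" "\<lambda>l. \<Sum>p\<in>P. of_bool (l \<in> c p) - mu p l"] insert.prems
    unfolding mu_def by auto
  have split: "(\<Sum>p'\<in>insert p P. of_bool (l \<in> (c(p := I)) p') - mu p' l)
      = (\<Sum>p\<in>P. of_bool (l \<in> c p) - mu p l) + (of_bool (l \<in> I) - mu p l)" for l
  proof -
    have "(\<Sum>p'\<in>P. of_bool (l \<in> (c(p := I)) p') - mu p' l) = (\<Sum>p\<in>P. of_bool (l \<in> c p) - mu p l)"
      using insert.hyps by (intro sum.cong) auto
    then show ?thesis using insert.hyps by simp
  qed
  have "(\<Sum>l\<in>K. (\<Sum>p'\<in>insert p P. of_bool (l \<in> (c(p := I)) p') - mu p' l)\<^sup>2)
      \<le> real (card K * card (insert p P))"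
    unfolding split using Ib cb insert.hyps by (simp add: algebra_simps)
  moreover have "\<forall>p'\<in>insert p P. (c(p := I)) p' \<subseteq> K \<and> 0 < q p' ((c(p := I)) p')"
    using c I by auto
  ultimately show ?case unfolding mu_def by blast
qed

section \<open>Sampling\<close>

context prob_space
begin

lemma distr_PiM_coordinate:
  assumes "i \<in> X"
  shows "distr (PiM X (\<lambda>_. M)) M (\<lambda>x. x i) = M"
  using distr_PiM_component[of X "\<lambda>_. M" i] assms prob_space_axioms by simp

lemma indep_vars_PiM_coordinates:
  assumes "X \<noteq> {}"
  shows "prob_space.indep_vars (PiM X (\<lambda>_. M)) (\<lambda>_. M) (\<lambda>i x. x i) X"
proof -
  interpret P: prob_space "PiM X (\<lambda>_. M)" by (intro prob_space_PiM prob_space_axioms)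
  have "distr (PiM X (\<lambda>_. M)) (PiM X (\<lambda>_. M)) (\<lambda>x. \<lambda>i\<in>X. x i) =
      distr (PiM X (\<lambda>_. M)) (PiM X (\<lambda>_. M)) (\<lambda>x. x)"
    by (rule distr_cong) (auto simp: space_PiM PiE_def extensional_restrict)
  also have "\<dots> = (\<Pi>\<^sub>M i\<in>X. distr (PiM X (\<lambda>_. M)) M (\<lambda>x. x i))"
    by (subst distr_id2, simp, intro PiM_cong) (simp_all add: distr_PiM_coordinate)
  finally show ?thesis
    using assms by (subst P.indep_vars_iff_distr_eq_PiM') auto
qed

lemma distr_PiM_pair:
  assumes "a \<in> X" "b \<in> X" "a \<noteq> b"
  shows "distr (PiM X (\<lambda>_. M)) (M \<Otimes>\<^sub>M M) (\<lambda>x. (x a, x b)) = M \<Otimes>\<^sub>M M"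
proof -
  interpret P: prob_space "PiM X (\<lambda>_. M)" by (intro prob_space_PiM prob_space_axioms)
  have "P.indep_vars (\<lambda>_. M) (\<lambda>i x. x i) X" 
    using assms by (intro indep_vars_PiM_coordinates) auto
  then have "P.indep_var (PiM {a} (\<lambda>_. M)) (\<lambda>x. restrict (\<lambda>i. x i) {a})
      (PiM {b} (\<lambda>_. M)) (\<lambda>x. restrict (\<lambda>i. x i) {b})"
    by (rule P.indep_var_restrict) (use assms in auto)
  then have "P.indep_var M ((\<lambda>y. y a) \<circ> (\<lambda>x. restrict (\<lambda>i. x i) {a})) M
      ((\<lambda>y. y b) \<circ> (\<lambda>x. restrict (\<lambda>i. x i) {b}))"
    by (rule P.indep_var_compose) auto
  then have "P.indep_var M (\<lambda>x. x a) M (\<lambda>x. x b)" by (simp add: o_def)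
  then show ?thesis
    using assms unfolding P.indep_var_distribution_eq
    by (simp add: distr_PiM_coordinate)
qed

lemma
  fixes f :: "'a \<times> 'a \<Rightarrow> real"
  assumes ab: "a \<in> X" "b \<in> X" "a \<noteq> b" and f: "f \<in> borel_measurable (M \<Otimes>\<^sub>M M)"
  shows integral_PiM_pair: "(\<integral>x. f (x a, x b) \<partial>PiM X (\<lambda>_. M)) = (\<integral>z. f z \<partial>(M \<Otimes>\<^sub>M M))"
    and measurable_PiM_pair: "(\<lambda>x. f (x a, x b)) \<in> borel_measurable (PiM X (\<lambda>_. M))"
proof -
  have *: "(\<lambda>x. (x a, x b)) \<in> measurable (PiM X (\<lambda>_. M)) (M \<Otimes>\<^sub>M M)"
    using ab by (intro measurable_Pair measurable_component_singleton)
  then show "(\<lambda>x. f (x a, x b)) \<in> borel_measurable (PiM X (\<lambda>_. M))"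
    using measurable_comp[OF * f] by (simp add: o_def)
  have "(\<integral>z. f z \<partial>(M \<Otimes>\<^sub>M M)) = (\<integral>z. f z \<partial>distr (PiM X (\<lambda>_. M)) (M \<Otimes>\<^sub>M M) (\<lambda>x. (x a, x b)))"
    using distr_PiM_pair[OF ab] by simp
  also have "\<dots> = (\<integral>x. f (x a, x b) \<partial>PiM X (\<lambda>_. M))"
    by (rule integral_distr) (use * f in auto)
  finally show "(\<integral>x. f (x a, x b) \<partial>PiM X (\<lambda>_. M)) = (\<integral>z. f z \<partial>(M \<Otimes>\<^sub>M M))" ..
qed

text \<open>Edges without a common vertex read disjoint blocks of independent coordinates, so the
  expectation of the product factorizes.\<close>

lemma integral_PiM_disjoint_pairs:
  fixes f :: "'a \<times> 'a \<Rightarrow> real"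
  assumes ab: "a \<in> X" "b \<in> X" "a \<noteq> b" and cd: "c \<in> X" "d \<in> X" "c \<noteq> d"
    and disj: "{a, b} \<inter> {c, d} = {}"
    and f: "f \<in> borel_measurable (M \<Otimes>\<^sub>M M)" and bd: "\<And>z. z \<in> space (M \<Otimes>\<^sub>M M) \<Longrightarrow> \<bar>f z\<bar> \<le> 1"
  shows "(\<integral>x. f (x a, x b) * f (x c, x d) \<partial>PiM X (\<lambda>_. M)) = (\<integral>z. f z \<partial>(M \<Otimes>\<^sub>M M))\<^sup>2"
proof -
  interpret P: prob_space "PiM X (\<lambda>_. M)" by (intro prob_space_PiM prob_space_axioms)
  have "P.indep_vars (\<lambda>_. M) (\<lambda>i x. x i) X" 
    using ab by (intro indep_vars_PiM_coordinates) auto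
  then have "P.indep_var (PiM {a,b} (\<lambda>_. M)) (\<lambda>x. restrict (\<lambda>i. x i) {a,b})
      (PiM {c,d} (\<lambda>_. M)) (\<lambda>x. restrict (\<lambda>i. x i) {c,d})"
    by (rule P.indep_var_restrict) (use ab cd disj in auto)
  then have "P.indep_var borel ((\<lambda>y. f (y a, y b)) \<circ> (\<lambda>x. restrict (\<lambda>i. x i) {a,b})) borel
      ((\<lambda>y. f (y c, y d)) \<circ> (\<lambda>x. restrict (\<lambda>i. x i) {c,d}))"
    by (rule P.indep_var_compose) (use ab cd f in \<open>auto intro!: measurable_PiM_pair\<close>)
  then have ind: "P.indep_var borel (\<lambda>x. f (x a, x b)) borel (\<lambda>x. f (x c, x d))" 
    by (simp add: o_def)
  have int: "integrable (PiM X (\<lambda>_. M)) (\<lambda>x. f (x a, x b))"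
    if "a \<in> X" "b \<in> X" "a \<noteq> b" for a b
    by (rule P.integrable_const_bound[of _ 1])
       (use that f in \<open>auto intro!: measurable_PiM_pair AE_I2 bd simp: space_PiM space_pair_measure PiE_mem\<close>)
  show ?thesis
    using P.indep_var_lebesgue_integral[OF ind int[OF ab] int[OF cd]]
    by (simp add: integral_PiM_pair[OF ab f] integral_PiM_pair[OF cd f] power2_eq_square)
qed

text \<open>Only pairs of edges that share a vertex are correlated.\<close>

lemma edge_sum_second_moment:
  fixes f :: "'a \<times> 'a \<Rightarrow> real"
  assumes T: "finite T" "T \<subseteq> X" and E: "E \<subseteq> T \<times> T" "\<And>a b. (a, b) \<in> E \<Longrightarrow> a \<noteq> b"
    and f: "f \<in> borel_measurable (M \<Otimes>\<^sub>M M)" and bd: "\<And>z. z \<in> space (M \<Otimes>\<^sub>M M) \<Longrightarrow> \<bar>f z\<bar> \<le> 1"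
    and mean: "(\<integral>z. f z \<partial>(M \<Otimes>\<^sub>M M)) = 0"
  defines "F \<equiv> \<lambda>x. \<Sum>(a, b)\<in>E. f (x a, x b)"
  shows "integrable (PiM X (\<lambda>_. M)) (\<lambda>x. (F x)\<^sup>2)"
    and "(\<integral>x. (F x)\<^sup>2 \<partial>PiM X (\<lambda>_. M)) \<le> 4 * real (card T) * real (card E)"
proof -
  interpret P: prob_space "PiM X (\<lambda>_. M)" by (intro prob_space_PiM prob_space_axioms)
  have finE: "finite E" using T E finite_subset by blast
  define g where "g p x = f (x (fst p), x (snd p))" for p :: "'b \<times> 'b" and x
  have inX: "fst p \<in> X" "snd p \<in> X" "fst p \<noteq> snd p" if "p \<in> E" for p
    using that E T by (cases p; auto)+
  have gm: "g p \<in> borel_measurable (PiM X (\<lambda>_. M))" if "p \<in> E" for p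
    unfolding g_def by (rule measurable_PiM_pair) (use inX[OF that] f in auto)
  have gb: "\<bar>g p x\<bar> \<le> 1" if "p \<in> E" "x \<in> space (PiM X (\<lambda>_. M))" for p x
    unfolding g_def using inX[OF that(1)] that(2)
    by (intro bd) (auto simp: space_PiM space_pair_measure PiE_mem)
  have ggb: "\<bar>g p x * g q x\<bar> \<le> 1" if "p \<in> E" "q \<in> E" "x \<in> space (PiM X (\<lambda>_. M))" for p q x
    using gb that by (simp add: abs_mult mult_le_one)
  have int: "integrable (PiM X (\<lambda>_. M)) (\<lambda>x. g p x * g q x)" if "p \<in> E" "q \<in> E" for p q
    by (rule P.integrable_const_bound[of _ 1]) 
       (use that gm ggb in \<open>auto intro!: AE_I2 borel_measurable_times\<close>)
  have F2: "(F x)\<^sup>2 = (\<Sum>p\<in>E. \<Sum>q\<in>E. g p x * g q x)" for x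
    unfolding F_def power2_eq_square sum_product g_def by (simp add: case_prod_unfold)
  show "integrable (PiM X (\<lambda>_. M)) (\<lambda>x. (F x)\<^sup>2)"
    unfolding F2 by (intro Bochner_Integration.integrable_sum int)
  define adj where "adj p = {q \<in> E. {fst p, snd p} \<inter> {fst q, snd q} \<noteq> {}}" for p
  have cov: "(\<integral>x. g p x * g q x \<partial>PiM X (\<lambda>_. M)) \<le> of_bool (q \<in> adj p)"
    if pq: "p \<in> E" "q \<in> E" for p q
  proof (cases "q \<in> adj p")
    case True
    have "(\<integral>x. g p x * g q x \<partial>PiM X (\<lambda>_. M)) \<le> 1"
      using ggb[OF pq] int[OF pq] by (intro P.integral_le_const AE_I2) (auto simp: abs_le_iff)
    then show ?thesis using True by simp
  next
    case False
    then have "(\<integral>x. g p x * g q x \<partial>PiM X (\<lambda>_. M)) = 0"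
      unfolding g_def using integral_PiM_disjoint_pairs[OF inX[OF pq(1)] inX[OF pq(2)] _ f bd] mean pq
      by (auto simp: adj_def)
    then show ?thesis by simp
  qed
  have card_adj: "card (adj p) \<le> 4 * card T" for p
  proof -
    \<comment> \<open>A pair that meets \<open>p\<close> has its first or its second entry in
      \<open>{fst p, snd p}\<close>, which leaves at most \<open>2 * card T\<close> pairs in either
      case.\<close>
    have "adj p \<subseteq> {fst p, snd p} \<times> T \<union> T \<times> {fst p, snd p}"
      using E unfolding adj_def by auto
    then have "card (adj p) \<le> card ({fst p, snd p} \<times> T \<union> T \<times> {fst p, snd p})"
      using T by (intro card_mono) auto
    also have "\<dots> \<le> card ({fst p, snd p} \<times> T) + card (T \<times> {fst p, snd p})" by (rule card_Un_le)
    also have "\<dots> \<le> 4 * card T"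
    proof -
      have "card {fst p, snd p} \<le> 2" by (rule card_insert_le_m1) auto
      then have "card {fst p, snd p} * card T \<le> 2 * card T" by (rule mult_le_mono1)
      then show ?thesis by (simp only: card_cartesian_product mult.commute[of "card T"])
    qed
    finally show ?thesis .
  qed
  have "(\<integral>x. (F x)\<^sup>2 \<partial>PiM X (\<lambda>_. M)) = (\<Sum>p\<in>E. \<Sum>q\<in>E. \<integral>x. g p x * g q x \<partial>PiM X (\<lambda>_. M))"
    unfolding F2 using int by (simp add: Bochner_Integration.integral_sum)
  also have "\<dots> \<le> (\<Sum>p\<in>E. \<Sum>q\<in>E. of_bool (q \<in> adj p))"
    by (intro sum_mono cov)
  also have "\<dots> = (\<Sum>p\<in>E. real (card (adj p)))"
    using finE by (intro sum.cong refl) (simp add: adj_def Int_def)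
  also have "\<dots> \<le> (\<Sum>p\<in>E. real (4 * card T))"
    using card_adj by (intro sum_mono) (simp only: of_nat_le_iff)
  finally show "(\<integral>x. (F x)\<^sup>2 \<partial>PiM X (\<lambda>_. M)) \<le> 4 * real (card T) * real (card E)"
    by (simp add: mult.commute)
qed

text \<open>Chebyshev's inequality for the centred sum. With about \<open>card T ^ 2\<close> pairs
  and \<open>D\<close> proportional to \<open>card E\<close> the bound has order
  \<open>1 / card T\<close>, small enough for a union bound over the colours. \<open>X\<close> may
  be larger than \<open>T\<close> because one sample space will also carry coordinates outside the
  sample. \<open>M\<close> will be Lebesgue measure on the unit interval or the uniform measure on
  the vertices of a system.\<close>

lemma edge_sum_concentration:
  fixes f :: "'a \<times> 'a \<Rightarrow> real" and t D :: real
  assumes T: "finite T" "T \<subseteq> X" and E: "E \<subseteq> T \<times> T" "\<And>a b. (a, b) \<in> E \<Longrightarrow> a \<noteq> b"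
    and f: "f \<in> borel_measurable (M \<Otimes>\<^sub>M M)"
    and bd: "\<And>z. z \<in> space (M \<Otimes>\<^sub>M M) \<Longrightarrow> 0 \<le> f z \<and> f z \<le> 1" and D: "0 < D"
  defines "t \<equiv> \<integral>z. f z \<partial>(M \<Otimes>\<^sub>M M)"
  shows "{x \<in> space (PiM X (\<lambda>_. M)). (\<Sum>(a, b)\<in>E. f (x a, x b)) \<le> t * card E - D} \<in> sets (PiM X (\<lambda>_. M))"
    and "measure (PiM X (\<lambda>_. M)) {x \<in> space (PiM X (\<lambda>_. M)). (\<Sum>(a, b)\<in>E. f (x a, x b)) \<le> t * card E - D}
      \<le> 4 * real (card T) * real (card E) / D\<^sup>2"
proof -
  interpret P: prob_space "PiM X (\<lambda>_. M)" by (intro prob_space_PiM prob_space_axioms)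
  interpret MM: pair_prob_space M M ..
  have intf: "integrable (M \<Otimes>\<^sub>M M) f"
    by (rule MM.P.integrable_const_bound[of _ 1]) (use f bd in \<open>auto intro!: AE_I2\<close>)
  have t: "0 \<le> t" "t \<le> 1"
    unfolding t_def using bd
    by (auto intro!: integral_nonneg_AE MM.P.integral_le_const AE_I2 intf)
  define h where "h z = f z - t" for z
  have hm: "h \<in> borel_measurable (M \<Otimes>\<^sub>M M)" unfolding h_def using f by measurable
  have hb: "\<bar>h z\<bar> \<le> 1" if "z \<in> space (M \<Otimes>\<^sub>M M)" for z
    unfolding h_def using bd[OF that] t by auto
  have h0: "(\<integral>z. h z \<partial>(M \<Otimes>\<^sub>M M)) = 0"
    unfolding h_def using intf by (simp add: t_def MM.P.prob_space)
  define F where "F x = (\<Sum>(a, b)\<in>E. h (x a, x b))" for x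
  have Feq: "F x = (\<Sum>(a, b)\<in>E. f (x a, x b)) - t * card E" for x
    unfolding F_def h_def by (simp add: case_prod_unfold sum_subtractf)
  note sm = edge_sum_second_moment[OF T E hm hb h0, folded F_def]
  have sm1: "integrable (PiM X (\<lambda>_. M)) (\<lambda>x. (F x)\<^sup>2)" 
    and sm2: "(\<integral>x. (F x)\<^sup>2 \<partial>PiM X (\<lambda>_. M)) \<le> 4 * real (card T) * real (card E)"
    using sm by auto
  have inX: "a \<in> X" "b \<in> X" "a \<noteq> b" if "(a, b) \<in> E" for a b using that E T by auto
  have fm: "(\<lambda>x. \<Sum>(a, b)\<in>E. f (x a, x b)) \<in> borel_measurable (PiM X (\<lambda>_. M))"
    unfolding case_prod_unfold
    by (intro borel_measurable_sum measurable_PiM_pair f) (auto dest: inX)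
  show m: "{x \<in> space (PiM X (\<lambda>_. M)). (\<Sum>(a, b)\<in>E. f (x a, x b)) \<le> t * card E - D} \<in> sets (PiM X (\<lambda>_. M))"
    using fm by measurable
  have "measure (PiM X (\<lambda>_. M)) {x \<in> space (PiM X (\<lambda>_. M)). (\<Sum>(a, b)\<in>E. f (x a, x b)) \<le> t * card E - D}
    \<le> measure (PiM X (\<lambda>_. M)) {x \<in> space (PiM X (\<lambda>_. M)). D\<^sup>2 \<le> (F x)\<^sup>2}"
  proof (rule P.finite_measure_mono)
    show "{x \<in> space (PiM X (\<lambda>_. M)). D\<^sup>2 \<le> (F x)\<^sup>2} \<in> sets (PiM X (\<lambda>_. M))"
      using borel_measurable_integrable[OF sm1] by measurable
    have "D\<^sup>2 \<le> (F x)\<^sup>2" if "(\<Sum>(a, b)\<in>E. f (x a, x b)) \<le> t * card E - D" for x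
    proof -
      have "D \<le> \<bar>F x\<bar>" using that unfolding Feq by linarith
      then show ?thesis using D by (metis abs_le_square_iff abs_of_pos)
    qed
    then show "{x \<in> space (PiM X (\<lambda>_. M)). (\<Sum>(a, b)\<in>E. f (x a, x b)) \<le> t * card E - D}
      \<subseteq> {x \<in> space (PiM X (\<lambda>_. M)). D\<^sup>2 \<le> (F x)\<^sup>2}" by auto
  qed
  also have "\<dots> \<le> (\<integral>x. (F x)\<^sup>2 \<partial>PiM X (\<lambda>_. M)) / D\<^sup>2"
    by (rule integral_Markov_inequality_measure[OF sm1 sets.top]) (use D in auto)
  also have "\<dots> \<le> 4 * real (card T) * real (card E) / D\<^sup>2"
    using sm2 by (intro divide_right_mono) auto
  finally show "measure (PiM X (\<lambda>_. M)) {x \<in> space (PiM X (\<lambda>_. M)). (\<Sum>(a, b)\<in>E. f (x a, x b)) \<le> t * card E - D}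
      \<le> 4 * real (card T) * real (card E) / D\<^sup>2" .
qed

end

section \<open>Homomorphisms and step graphons\<close>

interpretation unit_measure: prob_space unit_measure
  by standard (simp add: unit_measure_def emeasure_restrict_space space_restrict_space)

interpretation unit_square: pair_prob_space unit_measure unit_measure ..

lemma space_unit_measure [simp]: "space unit_measure = {0..1}"
  by (simp add: unit_measure_def space_restrict_space)

lemma space_unit_square: "space (unit_measure \<Otimes>\<^sub>M unit_measure) = {0..1} \<times> {0..1}"
  by (simp add: space_pair_measure)

text \<open>The defining recursion is Moebius inversion over supersets. At a point, the overlined
  value of \<open>J\<close> is to be read as the weight of having exactly the colours
  \<open>J\<close>, and \<open>W I\<close> as the weight of having at least the colours
  \<open>I\<close>.\<close>

lemma overline_system_sum:
  assumes "I \<subseteq> {1..k}"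
  shows "W I z = (\<Sum>J\<in>{J. I \<subseteq> J \<and> J \<subseteq> {1..k}}. overline_system k W J z)"
proof -
  have "{J. I \<subseteq> J \<and> J \<subseteq> {1..k}} = insert I {J. I \<subset> J \<and> J \<subseteq> {1..k}}" using assms by auto
  moreover have "finite {J. I \<subset> J \<and> J \<subseteq> {1..k}}"
    by (rule finite_subset[of _ "Pow {1..k}"]) auto
  ultimately have "(\<Sum>J\<in>{J. I \<subseteq> J \<and> J \<subseteq> {1..k}}. overline_system k W J z) =
      overline_system k W I z + (\<Sum>J\<in>{J. I \<subset> J \<and> J \<subseteq> {1..k}}. overline_system k W J z)"
    by (metis (no_types, lifting) mem_Collect_eq psubsetE subset_refl sum.insert)
  then show ?thesis by (simp add: overline_system.simps[of k W I z])
qed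

text \<open>Each value is determined by those at strictly larger sets, so the Moebius inverse is
  unique; the induction descends from \<open>{1..k}\<close>.\<close>

lemma overline_system_eqI:
  assumes W: "\<And>I. I \<subseteq> {1..k} \<Longrightarrow> W I z = (\<Sum>J\<in>{J. I \<subseteq> J \<and> J \<subseteq> {1..k}}. q J)"
    and "I \<subseteq> {1..k}"
  shows "overline_system k W I z = q I"
  using assms(2)
proof (induction "card ({1..k} - I)" arbitrary: I rule: less_induct)
  case less
  have eq: "{J. I \<subseteq> J \<and> J \<subseteq> {1..k}} = insert I {J. I \<subset> J \<and> J \<subseteq> {1..k}}" using less.prems by auto
  have fin: "finite {J. I \<subset> J \<and> J \<subseteq> {1..k}}"
    by (rule finite_subset[of _ "Pow {1..k}"]) auto
  have "overline_system k W J z = q J" if J: "J \<in> {J. I \<subset> J \<and> J \<subseteq> {1..k}}" for J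
  proof (rule less.hyps)
    show "card ({1..k} - J) < card ({1..k} - I)"
      using J less.prems by (intro psubset_card_mono) auto
  qed (use J in auto)
  then have "overline_system k W I z = W I z - (\<Sum>J\<in>{J. I \<subset> J \<and> J \<subseteq> {1..k}}. q J)"
    by (subst overline_system.simps) simp
  moreover have "W I z = q I + (\<Sum>J\<in>{J. I \<subset> J \<and> J \<subseteq> {1..k}}. q J)"
    unfolding W[OF less.prems] eq by (rule sum.insert[OF fin]) auto
  ultimately show ?case by simp
qed

lemma pair_value_doubleton:
  assumes "W (x u, x v) = W (x v, x u)"
  shows "pair_value W x {u, v} = W (x u, x v)"
  unfolding pair_value_def
  by (rule the_equality) (use assms in \<open>auto simp: doubleton_eq_iff\<close>)

section \<open>Colorings and rainbow homomorphisms\<close>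

definition colorings :: "nat \<Rightarrow> ('v, 'e) multigraph \<Rightarrow> ('e \<rightharpoonup> nat) \<Rightarrow> ('e \<Rightarrow> nat) set" where
  "colorings k H \<psi> = {\<rho> \<in> edges H \<rightarrow>\<^sub>E {1..k}. inj_on \<rho> (edges H) \<and> extends \<rho> \<psi>}"

text \<open>Vertices of \<open>H\<close> may be identified. If the members of \<open>G\<close> have
  two elements, the ends of an edge of \<open>H\<close> nevertheless keep distinct images.\<close>

definition rainbow_hom ::
    "('v, 'e) multigraph \<Rightarrow> (nat \<Rightarrow> 'a set set) \<Rightarrow> ('e \<Rightarrow> nat) \<Rightarrow> ('v \<Rightarrow> 'a) \<Rightarrow> bool" where
  "rainbow_hom H G \<rho> g \<longleftrightarrow> (\<forall>e\<in>edges H. g ` ends H e \<in> G (\<rho> e))"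

lemma finite_colorings: "finite (edges H) \<Longrightarrow> finite (colorings k H \<psi>)"
  unfolding colorings_def
  by (rule finite_subset[of _ "edges H \<rightarrow>\<^sub>E {1..k}"]) (auto intro: finite_PiE)

text \<open>Copies of \<open>H\<close> are images under injective homomorphisms. A copy pulls its
  coloring back along \<open>\<phi>E\<close>; conversely the image of \<open>H\<close> keeps the
  edges of \<open>H\<close> as edge objects, so parallel edges stay distinct and the edge map is the
  identity.\<close>

lemma rainbow_free_iff:
  fixes H :: "('v, 'e) multigraph" and V :: "'a set"
  assumes H: "loopless_multigraph H" and \<psi>: "rainbow_precoloring k H \<psi>"
    and G: "graph_system k V G"
  shows "rainbow_free k V G H \<psi> \<longleftrightarrow>
    \<not> (\<exists>\<rho>\<in>colorings k H \<psi>. \<exists>g. inj_on g (verts H) \<and> g ` verts H \<subseteq> V \<and> rainbow_hom H G \<rho> g)"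
    (is "_ \<longleftrightarrow> \<not> ?ex")
proof -
  have "?ex" if nf: "\<not> rainbow_free k V G H \<psi>"
  proof -
    obtain H' :: "('a, 'e) multigraph" and \<phi>V \<phi>E \<psi>' where
      H': "verts H' \<subseteq> V" "multigraph_iso H H' \<phi>V \<phi>E"
      "\<psi>' ` edges H' \<subseteq> {1..k}" "inj_on \<psi>' (edges H')" "extends (\<psi>' \<circ> \<phi>E) \<psi>"
      "\<forall>e\<in>edges H'. ends H' e \<in> G (\<psi>' e)"
      using nf unfolding rainbow_free_def by blast
    have bE: "bij_betw \<phi>E (edges H) (edges H')" and bV: "bij_betw \<phi>V (verts H) (verts H')"
      and e: "\<And>e. e \<in> edges H \<Longrightarrow> ends H' (\<phi>E e) = \<phi>V ` ends H e"
      using H'(2) unfolding multigraph_iso_def by auto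
    \<comment> \<open>Restriction makes the coloring extensional; it still extends
      \<open>\<psi>\<close> because \<open>dom \<psi>\<close> lies in
      \<open>edges H\<close>.\<close>
    define \<rho> where "\<rho> = restrict (\<psi>' \<circ> \<phi>E) (edges H)"
    have in': "\<phi>E e \<in> edges H'" if "e \<in> edges H" for e using bE that by (auto simp: bij_betw_def)
    have "inj_on (\<psi>' \<circ> \<phi>E) (edges H)"
      using bE H'(4) by (auto simp: bij_betw_def comp_inj_on)
    moreover have "extends \<rho> \<psi>"
      using H'(5) \<psi> unfolding extends_def \<rho>_def rainbow_precoloring_def by (auto simp: dom_def)
    ultimately have "\<rho> \<in> colorings k H \<psi>"
      using H'(3) in' unfolding colorings_def \<rho>_def by (auto simp: inj_on_restrict_eq)
    moreover have "rainbow_hom H G \<rho> \<phi>V"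
      unfolding rainbow_hom_def
    proof
      fix e' assume e': "e' \<in> edges H"
      show "\<phi>V ` ends H e' \<in> G (\<rho> e')"
        using bspec[OF H'(6) in'[OF e']] e[OF e'] e' by (simp add: \<rho>_def)
    qed
    moreover have "inj_on \<phi>V (verts H)" "\<phi>V ` verts H \<subseteq> V"
      using bV H'(1) by (auto simp: bij_betw_def)
    ultimately show ?ex by blast
  qed
  moreover have "\<not> rainbow_free k V G H \<psi>" if ex: ?ex
  proof -
    obtain \<rho> g where \<rho>: "\<rho> \<in> colorings k H \<psi>" and g: "inj_on g (verts H)" "g ` verts H \<subseteq> V"
      and hom: "rainbow_hom H G \<rho> g" using ex by blast
    define H' :: "('a, 'e) multigraph" where
      "H' = \<lparr>verts = g ` verts H, edges = edges H, ends = \<lambda>e. g ` ends H e\<rparr>"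
    have "loopless_multigraph H'"
      using H g unfolding loopless_multigraph_def H'_def
      by (simp add: card_image inj_on_subset image_mono)
    moreover have "multigraph_iso H H' g id"
      using g by (auto simp: multigraph_iso_def H'_def bij_betw_def)
    ultimately show ?thesis
      unfolding rainbow_free_def not_not
      using \<rho> g hom[unfolded rainbow_hom_def]
      by (intro exI[of _ H'] exI[of _ g] exI[of _ id] exI[of _ \<rho>] conjI)
        (auto simp only: H'_def colorings_def multigraph.simps mem_Collect_eq id_apply comp_id PiE_iff id_comp)
  qed
  ultimately show ?thesis by blast
qed

section \<open>Step graphons of finite graph systems\<close>

definition cell :: "nat \<Rightarrow> real \<Rightarrow> nat" where
  "cell m x = max 1 (nat \<lceil>real m * x\<rceil>)"

text \<open>Cells play the role of the vertices \<open>1..m\<close>. The value at \<open>I\<close>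
  is the product of the 0/1 step graphons of the colours in \<open>I\<close>, so the empty set
  automatically gives 1.\<close>

definition step_system :: "nat \<Rightarrow> (nat \<Rightarrow> nat set set) \<Rightarrow> nat set \<Rightarrow> real \<times> real \<Rightarrow> real" where
  "step_system m G I z = of_bool (\<forall>l\<in>I. {cell m (fst z), cell m (snd z)} \<in> G l)"

lemma cell_range: "x \<le> 1 \<Longrightarrow> 1 \<le> m \<Longrightarrow> cell m x \<in> {1..m}"
  using mult_left_mono[of x 1 "real m"] by (auto simp: cell_def ceiling_le_iff nat_le_iff)

lemma cell_eqI: "(real i - 1) / m < x \<Longrightarrow> x \<le> i / m \<Longrightarrow> 1 \<le> i \<Longrightarrow> 1 \<le> m \<Longrightarrow> cell m x = i"
proof -
  assume a: "(real i - 1) / m < x" "x \<le> i / m" "1 \<le> i" "1 \<le> m"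
  have "\<lceil>real m * x\<rceil> = int i"
    using a by (intro ceiling_unique) (auto simp: field_simps)
  then show ?thesis using a by (simp add: cell_def)
qed

lemma measurable_cells:
  "(\<lambda>z. (cell m (fst z), cell m (snd z))) \<in> measurable (unit_measure \<Otimes>\<^sub>M unit_measure) (count_space UNIV)"
proof -
  have [measurable]: "cell m \<in> measurable unit_measure (count_space UNIV)"
    unfolding unit_measure_def cell_def by (intro measurable_restrict_space1) measurable
  show ?thesis by measurable
qed

lemma measurable_step_system: "step_system m G I \<in> borel_measurable (unit_measure \<Otimes>\<^sub>M unit_measure)"
proof -
  have "(\<lambda>p. of_bool (\<forall>l\<in>I. {fst p, snd p} \<in> G l) :: real) \<in> measurable (count_space UNIV) borel" by simp
  from measurable_comp[OF measurable_cells this] show ?thesis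
    by (simp add: step_system_def[abs_def] o_def)
qed

text \<open>At every point the overlined system is a point mass: the set of all colours whose graph
  contains the pair of cells has weight 1, every other colour set has weight 0.\<close>

lemma admissible_step_system: "admissible k (step_system m G)"
proof -
  have "overline_system k (step_system m G) I z =
      of_bool (I = {l\<in>{1..k}. {cell m (fst z), cell m (snd z)} \<in> G l})" (is "_ = of_bool (I = ?C)")
    if "I \<subseteq> {1..k}" for I z
  proof (rule overline_system_eqI[OF _ that])
    fix I assume I: "I \<subseteq> {1..k}"
    have fin: "finite {J. I \<subseteq> J \<and> J \<subseteq> {1..k}}"
      by (rule finite_subset[of _ "Pow {1..k}"]) auto
    have "(\<Sum>J\<in>{J. I \<subseteq> J \<and> J \<subseteq> {1..k}}. of_bool (J = ?C)) = (of_bool (I \<subseteq> ?C) :: real)"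
      using fin by (auto simp: of_bool_def)
    also have "\<dots> = step_system m G I z" using I by (auto simp: step_system_def)
    finally show "step_system m G I z = (\<Sum>J\<in>{J. I \<subseteq> J \<and> J \<subseteq> {1..k}}. of_bool (J = ?C))" ..
  qed
  then show ?thesis
    unfolding admissible_def graphon_system_def graphon_def
    by (auto simp: measurable_step_system step_system_def insert_commute)
qed

text \<open>\<open>B i\<close> has length \<open>1 / m\<close> and lies in cell \<open>i\<close>.
  The \<open>max\<close> in \<open>cell\<close> puts the point 0 into the first cell as well, so
  rectangles of cells are compared by inclusion.\<close>

lemma measure_cell_rectangle:
  assumes "1 \<le> m" "i \<in> {1..m}" "j \<in> {1..m}"
  shows "1 / (real m)\<^sup>2 \<le> measure (unit_measure \<Otimes>\<^sub>M unit_measure)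
    {z \<in> space (unit_measure \<Otimes>\<^sub>M unit_measure). (cell m (fst z), cell m (snd z)) = (i, j)}"
proof -
  define B where "B i = {(real i - 1) / m <.. real i / m}" for i :: nat
  have sub: "B i \<subseteq> {0..1}" if "i \<in> {1..m}" for i
  proof -
    have "0 \<le> (real i - 1) / m" "real i / m \<le> 1" using that assms(1) by (auto simp: field_simps)
    then show ?thesis by (auto simp: B_def)
  qed
  have BS: "B i \<in> sets unit_measure" if "i \<in> {1..m}" for i
    using sub[OF that] by (auto simp: unit_measure_def sets_restrict_space_iff B_def)
  have BM: "emeasure unit_measure (B i) = ennreal (1 / m)" if "i \<in> {1..m}" for i
  proof -
    have "emeasure unit_measure (B i) = emeasure lborel (B i)"
      using sub[OF that] unfolding unit_measure_def by (intro emeasure_restrict_space) auto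
    also have "\<dots> = ennreal (1 / m)"
      unfolding B_def by (subst emeasure_lborel_Ioc) (use assms in \<open>auto simp: field_simps\<close>)
    finally show ?thesis .
  qed
  have "emeasure (unit_measure \<Otimes>\<^sub>M unit_measure) (B i \<times> B j) = ennreal (1 / (real m)\<^sup>2)"
    using assms by (simp add: unit_measure.emeasure_pair_measure_Times BS BM power2_eq_square flip: ennreal_mult)
  then have "1 / (real m)\<^sup>2 = measure (unit_measure \<Otimes>\<^sub>M unit_measure) (B i \<times> B j)"
    by (simp add: measure_def)
  also have "\<dots> \<le> measure (unit_measure \<Otimes>\<^sub>M unit_measure)
    {z \<in> space (unit_measure \<Otimes>\<^sub>M unit_measure). (cell m (fst z), cell m (snd z)) = (i, j)}"
  proof (rule unit_square.P.finite_measure_mono)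
    show "B i \<times> B j \<subseteq> {z \<in> space (unit_measure \<Otimes>\<^sub>M unit_measure). (cell m (fst z), cell m (snd z)) = (i, j)}"
    proof
      fix z assume z: "z \<in> B i \<times> B j"
      then have "z \<in> {0..1} \<times> {0..1}" using sub assms by blast
      moreover have "cell m (fst z) = i" "cell m (snd z) = j"
        using z assms by (auto simp: B_def intro!: cell_eqI)
      ultimately show "z \<in> {z \<in> space (unit_measure \<Otimes>\<^sub>M unit_measure). (cell m (fst z), cell m (snd z)) = (i, j)}"
        by (simp add: space_unit_square)
    qed
    show "{z \<in> space (unit_measure \<Otimes>\<^sub>M unit_measure). (cell m (fst z), cell m (snd z)) = (i, j)}
        \<in> sets (unit_measure \<Otimes>\<^sub>M unit_measure)"
      using measurable_sets[OF measurable_cells, of "{(i, j)}" m] by (simp add: vimage_def Int_def conj_commute)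
  qed
  finally show ?thesis .
qed

lemma card_ordered_edges:
  assumes "finite V" "\<And>e. e \<in> G \<Longrightarrow> e \<subseteq> V \<and> card e = 2"
  shows "card {(i, j). i \<in> V \<and> j \<in> V \<and> {i, j} \<in> G} = 2 * card G"
proof -
  have finG: "finite G" using assms by (auto intro: finite_subset[of _ "Pow V"])
  have eq: "{(i, j). i \<in> V \<and> j \<in> V \<and> {i, j} \<in> G} = (\<Union>e\<in>G. {(i, j). {i, j} = e})"
    using assms(2) by auto
  have two: "finite {(i, j). {i, j} = e} \<and> card {(i, j). {i, j} = e} = 2" if e: "e \<in> G" for e
  proof -
    obtain a b where ab: "e = {a, b}" "a \<noteq> b" using assms(2)[OF e] by (auto simp: card_2_iff)
    then have "{(i, j). {i, j} = e} = {(a, b), (b, a)}" by (auto simp: doubleton_eq_iff)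
    then show ?thesis using ab by simp
  qed
  show ?thesis unfolding eq using two finG by (subst card_UN_disjoint) auto
qed

text \<open>An edge fills two squares of area \<open>1 / m ^ 2\<close>. The diagonal squares carry
  no edge, so relative to \<open>m choose 2\<close> a factor \<open>1 - 1 / m\<close> is lost; a
  large \<open>m\<close> absorbs it.\<close>

lemma t_K2_step_system:
  assumes m: "1 \<le> m" and G: "\<And>e. e \<in> G l \<Longrightarrow> e \<subseteq> {1..m} \<and> card e = 2"
  shows "2 * real (card (G l)) / (real m)\<^sup>2 \<le> t_K2 (step_system m G {l})"
proof -
  let ?U = "unit_measure \<Otimes>\<^sub>M unit_measure"
  define R where "R = {(i, j). i \<in> {1..m} \<and> j \<in> {1..m} \<and> {i, j} \<in> G l}"
  define A where "A p = {z \<in> space ?U. (cell m (fst z), cell m (snd z)) = p}" for p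
  have finR: "finite R" unfolding R_def by (rule finite_subset[of _ "{1..m} \<times> {1..m}"]) auto
  have AS: "A p \<in> sets ?U" for p
    using measurable_sets[OF measurable_cells, of "{p}" m] by (simp add: A_def vimage_def Int_def conj_commute)
  have "t_K2 (step_system m G {l}) = (\<integral>z. (\<Sum>p\<in>R. indicator (A p) z) \<partial>?U)"
    unfolding t_K2_def
  proof (rule Bochner_Integration.integral_cong[OF refl])
    fix z assume z: "z \<in> space ?U"
    then have "cell m (fst z) \<in> {1..m}" "cell m (snd z) \<in> {1..m}"
      by (auto simp only: space_unit_square mem_Times_iff atLeastAtMost_iff[where 'a = real] intro!: cell_range m)
    then show "step_system m G {l} z = (\<Sum>p\<in>R. indicator (A p) z)"
      using z finR by (auto simp: step_system_def A_def indicator_def R_def of_bool_def)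
  qed
  also have "\<dots> = (\<Sum>p\<in>R. measure ?U (A p))"
    using AS by (subst Bochner_Integration.integral_sum) (auto simp: unit_square.P.emeasure_eq_measure)
  also have "\<dots> \<ge> (\<Sum>p\<in>R. 1 / (real m)\<^sup>2)"
    unfolding A_def by (intro sum_mono) (use m in \<open>auto simp: R_def simp del: prod.inject intro!: measure_cell_rectangle\<close>)
  also have "(\<Sum>p\<in>R. 1 / (real m)\<^sup>2) = 2 * real (card (G l)) / (real m)\<^sup>2"
    using card_ordered_edges[of "{1..m}" "G l"] G by (simp add: R_def)
  finally show ?thesis .
qed

text \<open>A point of the cube reads off a map from \<open>verts H\<close> to cells. If this map
  violates an edge of \<open>H\<close>, the factor of that edge is zero, so the integrand vanishes
  at every point.\<close>

lemma t_star_step_system: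
  assumes m: "1 \<le> m" and H: "loopless_multigraph H"
    and no_hom: "\<And>\<rho> g. \<rho> \<in> colorings k H \<psi> \<Longrightarrow> g \<in> verts H \<rightarrow>\<^sub>E {1..m} \<Longrightarrow> \<not> rainbow_hom H G \<rho> g"
  shows "t_star k H \<psi> (step_system m G) = 0"
proof -
  have "t_coloring H \<rho> (step_system m G) = 0" if \<rho>: "\<rho> \<in> colorings k H \<psi>" for \<rho>
  proof -
    have "(\<Prod>p\<in>{p. p \<subseteq> verts H \<and> card p = 2}.
        pair_value (step_system m G (\<rho> ` {e \<in> edges H. ends H e = p})) x p) = 0"
      if x: "x \<in> space (\<Pi>\<^sub>M v\<in>verts H. unit_measure)" for x
    proof -
      define g where "g = (\<lambda>v\<in>verts H. cell m (x v))"
      have "g \<in> verts H \<rightarrow>\<^sub>E {1..m}"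
      proof -
        have "x v \<le> 1" if "v \<in> verts H" for v using x that by (auto simp: space_PiM PiE_iff)
        then show ?thesis unfolding g_def restrict_PiE_iff using cell_range[OF _ m] by blast
      qed
      then obtain e where e: "e \<in> edges H" "g ` ends H e \<notin> G (\<rho> e)"
        using no_hom[OF \<rho>] unfolding rainbow_hom_def by blast
      have p: "ends H e \<subseteq> verts H" "card (ends H e) = 2"
        using H e unfolding loopless_multigraph_def by auto
      then obtain u v where uv: "ends H e = {u, v}" by (auto simp: card_2_iff)
      then have "step_system m G (\<rho> ` {e' \<in> edges H. ends H e' = {u, v}}) (x u, x v) = 0"
        using e p by (auto simp: step_system_def g_def)
      then have "pair_value (step_system m G (\<rho> ` {e' \<in> edges H. ends H e' = ends H e})) x (ends H e) = 0"
        unfolding uv by (subst pair_value_doubleton) (auto simp: step_system_def insert_commute)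
      moreover have "finite {p. p \<subseteq> verts H \<and> card p = 2}"
        using H by (auto simp: loopless_multigraph_def)
      ultimately show ?thesis using p by (intro prod_zero) auto
    qed
    then show ?thesis unfolding t_coloring_def by (subst Bochner_Integration.integral_cong[OF refl]) auto
  qed
  then show ?thesis unfolding t_star_def colorings_def by simp
qed

section \<open>Supersaturation\<close>

lemma sum_PiE_insert:
  fixes f :: "('a \<Rightarrow> 'b) \<Rightarrow> 'c::comm_monoid_add"
  assumes "x \<notin> U"
  shows "(\<Sum>g\<in>insert x U \<rightarrow>\<^sub>E N. f g) = (\<Sum>z\<in>U \<rightarrow>\<^sub>E N. \<Sum>a\<in>N. f (z(x := a)))"
proof -
  have "(\<Sum>g\<in>insert x U \<rightarrow>\<^sub>E N. f g) = (\<Sum>(a, z)\<in>N \<times> (U \<rightarrow>\<^sub>E N). f (z(x := a)))"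
    unfolding PiE_insert_eq
    using inj_combinator[OF assms, of "\<lambda>_. N"]
    by (subst sum.reindex) (auto simp: case_prod_unfold)
  also have "\<dots> = (\<Sum>z\<in>U \<rightarrow>\<^sub>E N. \<Sum>a\<in>N. f (z(x := a)))"
    unfolding sum.cartesian_product[symmetric] by (rule sum.swap)
  finally show ?thesis .
qed

text \<open>Since \<open>Q\<close> ignores the coordinate \<open>y\<close>, it can store a second
  value for \<open>x\<close>. For fixed remaining coordinates \<open>z\<close>, \<open>d z\<close>
  values suit \<open>x\<close> and \<open>(d z)^2\<close> pairs suit both; Cauchy-Schwarz over
  \<open>z\<close> compares the sum of \<open>d\<close> with its sum of squares.\<close>

lemma card_PiE_duplicate:
  fixes Q :: "('x \<Rightarrow> 'a) \<Rightarrow> bool"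
  assumes fin: "finite X" "finite N" and x: "x \<in> X" and y: "y \<in> X" "x \<noteq> y"
    and indep: "\<And>g a. Q (g(y := a)) = Q g"
  shows "(card {g \<in> X \<rightarrow>\<^sub>E N. Q g})\<^sup>2 \<le>
    card N ^ card X * card {g \<in> X \<rightarrow>\<^sub>E N. Q g \<and> Q (g(x := g y))}"
proof -
  define U where "U = X - {x, y}"
  define Z where "Z = U \<rightarrow>\<^sub>E N"
  have X: "X = insert x (insert y U)" "x \<notin> insert y U" "y \<notin> U" "finite U"
    using x y fin unfolding U_def by auto
  have finZ: "finite Z" unfolding Z_def using X(4) fin by (simp add: finite_PiE)
  have finX: "finite (X \<rightarrow>\<^sub>E N)" using fin by (simp add: finite_PiE)
  define d where "d z = (\<Sum>a\<in>N. of_bool (Q (z(x := a))) :: real)" for z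
  have card_sum: "real (card {g \<in> X \<rightarrow>\<^sub>E N. R g}) = (\<Sum>g\<in>X \<rightarrow>\<^sub>E N. of_bool (R g))" for R
    using finX by (simp add: Int_def)
  have cZ: "real (card N ^ card X) = (real (card N))\<^sup>2 * card Z"
    using X fin by (simp add: Z_def card_PiE power2_eq_square)
  have Q2: "Q (z(y := b, x := a)) = Q (z(x := a))" for z a b
    using indep[of "z(x := a)" b] y(2) by (simp add: fun_upd_twist)
  have "real (card {g \<in> X \<rightarrow>\<^sub>E N. Q g}) = (\<Sum>z\<in>Z. \<Sum>b\<in>N. \<Sum>a\<in>N. of_bool (Q (z(x := a))))"
    unfolding card_sum unfolding X(1) sum_PiE_insert[OF X(2)] sum_PiE_insert[OF X(3)] Z_def Q2 ..
  then have A: "real (card {g \<in> X \<rightarrow>\<^sub>E N. Q g}) = card N * (\<Sum>z\<in>Z. d z)"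
    unfolding d_def by (simp add: sum_distrib_left)
  have "real (card {g \<in> X \<rightarrow>\<^sub>E N. Q g \<and> Q (g(x := g y))})
      = (\<Sum>z\<in>Z. \<Sum>b\<in>N. \<Sum>a\<in>N. of_bool (Q (z(x := a)) \<and> Q (z(x := b))))"
    unfolding card_sum unfolding X(1) sum_PiE_insert[OF X(2)] sum_PiE_insert[OF X(3)] Z_def
    using y(2) by (simp add: Q2)
  also have "\<dots> = (\<Sum>z\<in>Z. (d z)\<^sup>2)"
    unfolding d_def power2_eq_square sum_product by (simp add: of_bool_conj mult.commute)
  finally have B: "real (card {g \<in> X \<rightarrow>\<^sub>E N. Q g \<and> Q (g(x := g y))}) = (\<Sum>z\<in>Z. (d z)\<^sup>2)" .
  have "(\<Sum>z\<in>Z. d z)\<^sup>2 \<le> card Z * (\<Sum>z\<in>Z. (d z)\<^sup>2)"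
    using sum_squared_le_sum_of_squares[of d Z] finZ by (simp add: mult.commute)
  then have "(real (card N))\<^sup>2 * (\<Sum>z\<in>Z. d z)\<^sup>2 \<le> (real (card N))\<^sup>2 * (card Z * (\<Sum>z\<in>Z. (d z)\<^sup>2))"
    by (intro mult_left_mono) auto
  then have "(real (card {g \<in> X \<rightarrow>\<^sub>E N. Q g}))\<^sup>2 \<le>
      real (card N ^ card X) * card {g \<in> X \<rightarrow>\<^sub>E N. Q g \<and> Q (g(x := g y))}"
    unfolding A B cZ by (simp add: power_mult_distrib mult.assoc)
  then show ?thesis by (simp flip: of_nat_power of_nat_mult)
qed

text \<open>This turns probabilities of sampled tuples into numbers of maps, the form in which
  Cauchy-Schwarz is applied.\<close>

lemma PiM_uniform_count_measure:
  assumes "finite X" "finite N" "N \<noteq> {}"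
  shows "(\<Pi>\<^sub>M i\<in>X. uniform_count_measure N) = uniform_count_measure (X \<rightarrow>\<^sub>E N)"
proof -
  interpret prob_space "uniform_count_measure N"
    using assms by (intro prob_space_uniform_count_measure)
  interpret product_sigma_finite "\<lambda>_. uniform_count_measure N" ..
  have fin: "finite (X \<rightarrow>\<^sub>E N)" using assms by (simp add: finite_PiE)
  have "sets (\<Pi>\<^sub>M i\<in>X. uniform_count_measure N) = sets (\<Pi>\<^sub>M i\<in>X. count_space N)"
    by (intro sets_PiM_cong) (auto simp: sets_uniform_count_measure)
  also have "\<dots> = Pow (X \<rightarrow>\<^sub>E N)"
    using assms by (subst count_space_PiM_finite) (auto simp: countable_finite)
  finally have sets: "sets (\<Pi>\<^sub>M i\<in>X. uniform_count_measure N) = Pow (X \<rightarrow>\<^sub>E N)" .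
  show ?thesis
  proof (rule measure_eqI_finite[OF sets _ fin])
    show "sets (uniform_count_measure (X \<rightarrow>\<^sub>E N)) = Pow (X \<rightarrow>\<^sub>E N)"
      by (simp add: sets_uniform_count_measure)
    fix g assume g: "g \<in> X \<rightarrow>\<^sub>E N"
    have gs: "{g} = (\<Pi>\<^sub>E i\<in>X. {g i})" using g PiE_singleton[of g X] by (auto simp: PiE_def)
    have "emeasure (\<Pi>\<^sub>M i\<in>X. uniform_count_measure N) {g} = (\<Prod>i\<in>X. emeasure (uniform_count_measure N) {g i})"
      using assms g unfolding gs by (subst emeasure_PiM) (auto simp: sets_uniform_count_measure)
    also have "\<dots> = (\<Prod>i\<in>X. ennreal (1 / card N))"
      using assms g by (intro prod.cong refl) (subst emeasure_uniform_count_measure, auto)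
    also have "\<dots> = ennreal (1 / card (X \<rightarrow>\<^sub>E N))"
      using assms by (simp add: card_PiE ennreal_power power_one_over)
    finally show "emeasure (\<Pi>\<^sub>M i\<in>X. uniform_count_measure N) {g} = emeasure (uniform_count_measure (X \<rightarrow>\<^sub>E N)) {g}"
      using g fin by (simp add: emeasure_uniform_count_measure)
  qed
qed

lemma card_PiE_coincidence:
  assumes "finite X" "finite N" "x \<in> X" "y \<in> X" "x \<noteq> y"
  shows "card {g \<in> X \<rightarrow>\<^sub>E N. g x = g y} * card N = card N ^ card X"
proof -
  define U where "U = X - {x}"
  have X: "X = insert x U" "x \<notin> U" "y \<in> U" "finite U" using assms by (auto simp: U_def)
  have fin: "finite (U \<rightarrow>\<^sub>E N)" using X assms by (simp add: finite_PiE)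
  have "card {g \<in> X \<rightarrow>\<^sub>E N. g x = g y} = (\<Sum>g\<in>X \<rightarrow>\<^sub>E N. of_bool (g x = g y))"
    using assms by (simp add: finite_PiE Int_def)
  also have "\<dots> = (\<Sum>z\<in>U \<rightarrow>\<^sub>E N. \<Sum>a\<in>N. of_bool (a = z y))"
    unfolding X(1) sum_PiE_insert[OF X(2)] using assms(5) by (intro sum.cong refl) (simp add: of_bool_def)
  also have "\<dots> = (\<Sum>z\<in>U \<rightarrow>\<^sub>E N. 1)"
    using X assms by (intro sum.cong refl) (auto simp: of_bool_def PiE_mem)
  finally show ?thesis using X assms by (simp add: card_PiE)
qed

text \<open>Mapping the vertices of \<open>H\<close> one after another to coordinates of their own turns a family of
  homomorphisms that identify vertices into a family that generically does not.\<close>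

lemma rainbow_hom_spread:
  fixes H :: "('v, 'e) multigraph" and G :: "nat \<Rightarrow> 'a set set" and a :: "'v \<Rightarrow> 'i"
    and \<delta> :: real
  assumes H: "loopless_multigraph H" and G: "\<And>e. e \<in> edges H \<Longrightarrow> \<forall>f\<in>G (\<rho> e). card f = 2"
    and fin: "finite X" "finite N" and X: "Inl ` verts H \<subseteq> X" "(Inr \<circ> a) ` verts H \<subseteq> X"
    and \<delta>: "0 \<le> \<delta>" "\<delta> * card N ^ card X \<le> card {g \<in> X \<rightarrow>\<^sub>E N. rainbow_hom H G \<rho> (g \<circ> Inr \<circ> a)}"
    and S: "S \<subseteq> verts H"
  shows "\<delta> ^ 2 ^ card S * card N ^ card X
    \<le> card {g \<in> X \<rightarrow>\<^sub>E N. rainbow_hom H G \<rho> (\<lambda>v. g (if v \<in> S then Inl v else Inr (a v)))}"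
proof -
  have "finite S" using S H by (auto simp: loopless_multigraph_def intro: finite_subset)
  then show ?thesis using S
  proof (induction S rule: finite_induct)
    case empty
    then show ?case using \<delta> by (simp add: o_def)
  next
    case (insert v S)
    \<comment> \<open>Vertices in \<open>S\<close> already have a coordinate of their own; the
      others still sit at the sample coordinate chosen by the pattern \<open>a\<close>.\<close>
    define h where "h S w = (if w \<in> S then Inl w else Inr (a w) :: 'v + 'i)" for S w
    define Q where "Q S g = rainbow_hom H G \<rho> (\<lambda>w. g (h S w))" for S g
    define n where "n = real (card N ^ card X)"
    have v: "v \<in> verts H" "v \<notin> S" using insert by auto
    have IH: "\<delta> ^ 2 ^ card S * n \<le> card {g \<in> X \<rightarrow>\<^sub>E N. Q S g}"
      using insert by (auto simp: Q_def h_def n_def)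
    \<comment> \<open>The second condition describes the world in which \<open>v\<close> has moved
      to its own coordinate. Other vertices with the same \<open>a\<close>-value move along, so it
      is read only at the edges containing \<open>v\<close>; all remaining edges use the first
      condition.\<close>
    have sub: "{g \<in> X \<rightarrow>\<^sub>E N. Q S g \<and> Q S (g(Inr (a v) := g (Inl v)))} \<subseteq> {g \<in> X \<rightarrow>\<^sub>E N. Q (insert v S) g}"
    proof clarify
      fix g assume g: "Q S g" "Q S (g(Inr (a v) := g (Inl v)))"
      show "Q (insert v S) g"
        unfolding Q_def rainbow_hom_def
      proof
        fix e assume e: "e \<in> edges H"
        have c2: "card (ends H e) = 2" using H e by (auto simp: loopless_multigraph_def)
        have ge: "(\<lambda>w. g (h S w)) ` ends H e \<in> G (\<rho> e)" using g(1) e by (auto simp: Q_def rainbow_hom_def)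
        show "(\<lambda>w. g (h (insert v S) w)) ` ends H e \<in> G (\<rho> e)"
        proof (cases "v \<in> ends H e")
          case False
          then have "(\<lambda>w. g (h (insert v S) w)) ` ends H e = (\<lambda>w. g (h S w)) ` ends H e"
            by (intro image_cong) (auto simp: h_def)
          then show ?thesis using ge by simp
        next
          case True
          obtain w where w: "ends H e = {v, w}" "w \<noteq> v"
          proof -
            obtain x y where "ends H e = {x, y}" "x \<noteq> y" using c2 by (auto simp: card_2_iff)
            then show ?thesis using True that[of x] that[of y] by (auto simp: insert_commute)
          qed
          \<comment> \<open>A neighbour of \<open>v\<close> cannot share its coordinate: the edge
            would collapse to one point, but edges of \<open>G\<close> have two.\<close>
          have "h S w \<noteq> Inr (a v)"
          proof
            assume "h S w = Inr (a v)"
            then have "(\<lambda>w. g (h S w)) ` ends H e = {g (Inr (a v))}"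
              using v by (auto simp: w h_def)
            then show False using G[OF e] ge by force
          qed
          then have "(\<lambda>w. g (h (insert v S) w)) ` ends H e
              = (\<lambda>w. (g(Inr (a v) := g (Inl v))) (h S w)) ` ends H e"
            using v w(2) by (simp add: w(1)) (auto simp: h_def)
          then show ?thesis using g(2) e by (auto simp: Q_def rainbow_hom_def)
        qed
      qed
    qed
    have "(real (card {g \<in> X \<rightarrow>\<^sub>E N. Q S g}))\<^sup>2 \<le>
      n * card {g \<in> X \<rightarrow>\<^sub>E N. Q S g \<and> Q S (g(Inr (a v) := g (Inl v)))}"
    proof -
      \<comment> \<open>The coordinate \<open>Inl v\<close> is still unread because \<open>v\<close>
        is outside \<open>S\<close>; it serves as the spare coordinate of the duplication.\<close>
      have "Q S (g(Inl v := c)) = Q S g" for g c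
      proof -
        have "(g(Inl v := c)) (h S w) = g (h S w)" for w using v by (auto simp: h_def)
        then show ?thesis by (simp add: Q_def)
      qed
      from card_PiE_duplicate[OF fin _ _ _ this, of "Inr (a v)"] show ?thesis
        using X v unfolding n_def by (simp add: image_subset_iff fun_upd_def flip: of_nat_power of_nat_mult)
    qed
    also have "\<dots> \<le> n * card {g \<in> X \<rightarrow>\<^sub>E N. Q (insert v S) g}"
      using fin by (intro mult_left_mono of_nat_mono card_mono[OF _ sub]) (auto simp: n_def finite_PiE)
    finally have le: "(real (card {g \<in> X \<rightarrow>\<^sub>E N. Q S g}))\<^sup>2 \<le> n * card {g \<in> X \<rightarrow>\<^sub>E N. Q (insert v S) g}" .
    have "\<delta> ^ 2 ^ card (insert v S) * n \<le> card {g \<in> X \<rightarrow>\<^sub>E N. Q (insert v S) g}"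
    proof (cases "n = 0")
      case False
      then have n: "0 < n" by (simp add: n_def)
      \<comment> \<open>Squaring the share doubles the exponent \<open>2 ^ card S\<close>, which is
        exactly one more vertex in \<open>S\<close>.\<close>
      have "n * (\<delta> ^ 2 ^ card (insert v S) * n) = (\<delta> ^ 2 ^ card S * n)\<^sup>2"
        using insert.hyps by (simp add: power2_eq_square power_mult_distrib algebra_simps mult_2 power_add)
      also have "\<dots> \<le> (real (card {g \<in> X \<rightarrow>\<^sub>E N. Q S g}))\<^sup>2"
        using IH \<delta> n by (intro power_mono) auto
      also note le
      finally show ?thesis using n by simp
    qed simp
    then show ?case by (simp add: Q_def h_def n_def)
  qed
qed

text \<open>Once every vertex of \<open>H\<close> has its own coordinate, the share of homomorphisms
  is still \<open>\<delta>\<close> to the power \<open>2 ^ card (verts H)\<close>. Freeness forces a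
  coincidence in each of them, and two given coordinates coincide only with share
  \<open>1 / card N\<close>. Hence \<open>N\<close> cannot be large.\<close>

lemma rainbow_hom_density:
  fixes H :: "('v, 'e) multigraph" and G :: "nat \<Rightarrow> 'a set set" and a :: "'v \<Rightarrow> 'i"
    and \<delta> :: real
  assumes H: "loopless_multigraph H" and G: "graph_system k N G"
    and free: "\<And>g. inj_on g (verts H) \<Longrightarrow> g ` verts H \<subseteq> N \<Longrightarrow> \<not> rainbow_hom H G \<rho> g"
    and \<rho>: "\<rho> \<in> colorings k H \<psi>"
    and fin: "finite X" "finite N" "N \<noteq> {}" and X: "Inl ` verts H \<subseteq> X" "(Inr \<circ> a) ` verts H \<subseteq> X"
    and \<delta>: "0 \<le> \<delta>" "\<delta> * card N ^ card X \<le> card {g \<in> X \<rightarrow>\<^sub>E N. rainbow_hom H G \<rho> (g \<circ> Inr \<circ> a)}"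
  shows "\<delta> ^ 2 ^ card (verts H) * card N \<le> (real (card (verts H)))\<^sup>2"
proof -
  define V where "V = verts H"
  have finV: "finite V" using H by (auto simp: V_def loopless_multigraph_def)
  define n where "n = real (card N ^ card X)"
  have N0: "0 < card N" using fin by (simp add: card_gt_0_iff)
  have n: "0 < n" using N0 by (simp add: n_def)
  define C where "C p = {g \<in> X \<rightarrow>\<^sub>E N. g (Inl (fst p)) = g (Inl (snd p))}" for p :: "'v \<times> 'v"
  define D where "D = {p \<in> V \<times> V. fst p \<noteq> snd p}"
  have finD: "finite D" using finV by (simp add: D_def)
  have G2: "\<forall>f\<in>G (\<rho> e). card f = 2" if "e \<in> edges H" for e
    using G \<rho> that by (auto simp: graph_system_def colorings_def PiE_iff)
  have "\<delta> ^ 2 ^ card V * n \<le> card {g \<in> X \<rightarrow>\<^sub>E N. rainbow_hom H G \<rho> (\<lambda>v. g (if v \<in> V then Inl v else Inr (a v)))}"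
    unfolding V_def n_def using rainbow_hom_spread[OF H G2 fin(1,2) X \<delta> order_refl] by simp
  also have "\<dots> \<le> card (\<Union>p\<in>D. C p)"
  proof (intro of_nat_mono card_mono)
    show "finite (\<Union>p\<in>D. C p)" using finD fin by (auto simp: C_def finite_PiE)
    show "{g \<in> X \<rightarrow>\<^sub>E N. rainbow_hom H G \<rho> (\<lambda>v. g (if v \<in> V then Inl v else Inr (a v)))} \<subseteq> (\<Union>p\<in>D. C p)"
    proof clarify
      fix g assume g: "g \<in> X \<rightarrow>\<^sub>E N" "rainbow_hom H G \<rho> (\<lambda>v. g (if v \<in> V then Inl v else Inr (a v)))"
      have "\<not> inj_on (\<lambda>v. g (if v \<in> V then Inl v else Inr (a v))) (verts H)"
        using g free[of "\<lambda>v. g (if v \<in> V then Inl v else Inr (a v))"] X by (auto simp: V_def PiE_mem)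
      then obtain u v where "u \<in> V" "v \<in> V" "u \<noteq> v" "g (Inl u) = g (Inl v)"
        by (auto simp: inj_on_def V_def)
      then show "g \<in> (\<Union>p\<in>D. C p)" using g(1) by (intro UN_I[of "(u, v)"]) (auto simp: D_def C_def)
    qed
  qed
  also have "\<dots> \<le> real (\<Sum>p\<in>D. card (C p))" by (intro of_nat_mono card_UN_le finD)
  finally have le: "\<delta> ^ 2 ^ card V * n \<le> (\<Sum>p\<in>D. real (card (C p)))" by simp
  have "(\<delta> ^ 2 ^ card V * card N) * n \<le> (\<Sum>p\<in>D. real (card (C p))) * card N"
    using mult_right_mono[OF le, of "card N"] by (simp add: algebra_simps)
  also have "\<dots> = (\<Sum>p\<in>D. n)"
    unfolding sum_distrib_right
  proof (rule sum.cong[OF refl])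
    fix p assume p: "p \<in> D"
    have "card (C p) * card N = card N ^ card X"
      unfolding C_def using p X by (intro card_PiE_coincidence fin) (auto simp: D_def V_def)
    then show "real (card (C p)) * real (card N) = n" by (simp add: n_def flip: of_nat_mult)
  qed
  also have "\<dots> \<le> (real (card V))\<^sup>2 * n"
  proof -
    have "card D \<le> card (V \<times> V)" unfolding D_def using finV by (intro card_mono) auto
    then have "real (card D) \<le> (real (card V))\<^sup>2"
      by (simp add: card_cartesian_product power2_eq_square flip: of_nat_mult)
    then show ?thesis using n by simp
  qed
  finally show ?thesis using n by (simp add: V_def)
qed

section \<open>Bounded vertex samples of dense systems\<close>

definition up_pairs :: "nat \<Rightarrow> (nat \<times> nat) set" where
  "up_pairs m = {(i, j). 1 \<le> i \<and> i < j \<and> j \<le> m}"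

text \<open>Listing the smaller element first selects one orientation per pair, so edge counts
  become sums over ordered pairs, as in the concentration bound.\<close>

lemma bij_betw_up_pairs:
  "bij_betw (\<lambda>(i, j). {i, j}) (up_pairs m) {p. p \<subseteq> {1..m} \<and> card p = 2}"
proof (rule bij_betw_imageI)
  show "inj_on (\<lambda>(i, j). {i, j}) (up_pairs m)"
    by (auto simp: inj_on_def up_pairs_def doubleton_eq_iff)
  have "p \<in> (\<lambda>(i, j). {i, j}) ` up_pairs m" if p: "p \<subseteq> {1..m}" "card p = 2" for p
  proof -
    obtain i j where ij: "p = {i, j}" "i \<noteq> j" using p by (auto simp: card_2_iff)
    then have "(i, j) \<in> up_pairs m \<or> (j, i) \<in> up_pairs m" using p by (auto simp: up_pairs_def)
    then show ?thesis using ij by (force simp: insert_commute)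
  qed
  then show "(\<lambda>(i, j). {i, j}) ` up_pairs m = {p. p \<subseteq> {1..m} \<and> card p = 2}"
    by (auto simp: up_pairs_def)
qed

lemma finite_up_pairs [simp]: "finite (up_pairs m)"
  by (rule finite_subset[of _ "{1..m} \<times> {1..m}"]) (auto simp: up_pairs_def)

lemma card_up_pairs: "card (up_pairs m) = m choose 2"
  using bij_betw_same_card[OF bij_betw_up_pairs[of m]] by (simp add: n_subsets)

lemma choose_2_real: "real (m choose 2) = real m * (real m - 1) / 2"
  by (cases m) (auto simp: choose_two real_of_nat_div algebra_simps)

lemma integral_uniform_pair:
  fixes f :: "'a \<times> 'a \<Rightarrow> real"
  assumes N: "finite N" "N \<noteq> {}"
  shows "f \<in> borel_measurable (uniform_count_measure N \<Otimes>\<^sub>M uniform_count_measure N)"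
    and "(\<integral>z. f z \<partial>(uniform_count_measure N \<Otimes>\<^sub>M uniform_count_measure N))
      = (\<Sum>z\<in>N \<times> N. f z) / (real (card N))\<^sup>2"
proof -
  interpret prob_space "uniform_count_measure N"
    using N by (intro prob_space_uniform_count_measure)
  interpret MM: pair_prob_space "uniform_count_measure N" "uniform_count_measure N" ..
  let ?MM = "uniform_count_measure N \<Otimes>\<^sub>M uniform_count_measure N"
  have "sets ?MM = sets (count_space N \<Otimes>\<^sub>M count_space N)"
    by (intro sets_pair_measure_cong) (auto simp: sets_uniform_count_measure)
  also have "\<dots> = Pow (N \<times> N)"
    using N by (subst pair_measure_countable) (auto intro: countable_finite)
  finally have sets: "sets ?MM = Pow (N \<times> N)" .
  have sp: "space ?MM = N \<times> N" by (simp add: space_pair_measure space_uniform_count_measure)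
  show f: "f \<in> borel_measurable ?MM"
    by (rule measurableI) (auto simp: sets sp)
  have fin: "finite (f ` (N \<times> N))" using N by simp
  have "integrable ?MM f"
    by (rule MM.P.integrable_const_bound[of _ "Max ((\<lambda>z. \<bar>f z\<bar>) ` (N \<times> N))"])
      (use N f in \<open>auto intro!: AE_I2 Max_ge simp: sp\<close>)
  then have "(\<integral>z. f z \<partial>?MM) = (\<integral>x. \<integral>y. f (x, y) \<partial>uniform_count_measure N \<partial>uniform_count_measure N)"
    by (rule MM.integral_fst'[symmetric])
  also have "\<dots> = (\<Sum>x\<in>N. \<Sum>y\<in>N. f (x, y)) / (real (card N))\<^sup>2"
    using N by (simp add: integral_uniform_count_measure power2_eq_square flip: sum_divide_distrib)
  finally show "(\<integral>z. f z \<partial>?MM) = (\<Sum>z\<in>N \<times> N. f z) / (real (card N))\<^sup>2"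
    by (simp add: sum.cartesian_product)
qed

text \<open>The sample \<open>y\<close> may repeat vertices. A pair with \<open>y i = y j\<close>
  has a singleton image, which is not an edge of a simple graph, so repetitions only cost
  density.\<close>

definition induced_system :: "(nat \<Rightarrow> 'a set set) \<Rightarrow> nat \<Rightarrow> (nat \<Rightarrow> 'a) \<Rightarrow> nat \<Rightarrow> nat set set" where
  "induced_system G m y l = {p. p \<subseteq> {1..m} \<and> card p = 2 \<and> y ` p \<in> G l}"

lemma card_induced_system:
  "real (card (induced_system G m y l)) = (\<Sum>(i, j)\<in>up_pairs m. of_bool ({y i, y j} \<in> G l))"
proof -
  have fin: "finite {p. p \<subseteq> {1..m} \<and> card p = 2}" by simp
  have "real (card (induced_system G m y l)) = (\<Sum>p\<in>{p. p \<subseteq> {1..m} \<and> card p = 2}. of_bool (y ` p \<in> G l))"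
    using fin by (simp add: induced_system_def Int_def conj_assoc)
  also have "\<dots> = (\<Sum>(i, j)\<in>up_pairs m. of_bool ({y i, y j} \<in> G l))"
    by (subst sum.reindex_bij_betw[OF bij_betw_up_pairs, symmetric]) (simp add: case_prod_unfold)
  finally show ?thesis .
qed

lemma rainbow_hom_induced_system:
  "rainbow_hom H (induced_system G m y) \<rho> a \<Longrightarrow> rainbow_hom H G \<rho> (y \<circ> a)"
  by (auto simp: rainbow_hom_def induced_system_def image_comp)

text \<open>Without a homomorphism the step system of the sample would have \<open>t_star\<close>
  zero and thus compete in the supremum, although all its densities exceed \<open>s\<close>.\<close>

lemma induced_system_hom:
  assumes k: "1 \<le> k" and H: "loopless_multigraph H" and m: "1 \<le> m"
    and bound: "\<And>W. admissible k W \<Longrightarrow> t_star k H \<psi> W = 0 \<Longrightarrow> Min ((\<lambda>l. t_K2 (W {l})) ` {1..k}) \<le> s"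
    and dense: "\<And>l. l \<in> {1..k} \<Longrightarrow> s < 2 * (\<Sum>(i, j)\<in>up_pairs m. of_bool ({y i, y j} \<in> G l)) / (real m)\<^sup>2"
  shows "\<exists>\<rho>\<in>colorings k H \<psi>. \<exists>a\<in>verts H \<rightarrow>\<^sub>E {1..m}. rainbow_hom H G \<rho> (y \<circ> a)"
proof (rule ccontr)
  assume "\<not> ?thesis"
  then have "t_star k H \<psi> (step_system m (induced_system G m y)) = 0"
    using rainbow_hom_induced_system by (intro t_star_step_system m H) blast
  then have "Min ((\<lambda>l. t_K2 (step_system m (induced_system G m y) {l})) ` {1..k}) \<le> s"
    by (rule bound[OF admissible_step_system])
  then obtain l where l: "l \<in> {1..k}" "t_K2 (step_system m (induced_system G m y) {l}) \<le> s"
    using k by (subst (asm) Min_le_iff) auto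
  have "2 * real (card (induced_system G m y l)) / (real m)\<^sup>2
      \<le> t_K2 (step_system m (induced_system G m y) {l})"
    by (rule t_K2_step_system[OF m]) (auto simp: induced_system_def)
  then show False using l dense[OF l(1)] unfolding card_induced_system by linarith
qed

text \<open>The excess \<open>\<epsilon>\<close> over \<open>s\<close> is spent in three portions:
  \<open>\<epsilon> / 2\<close> on independent vertices, which may coincide;
  \<open>\<epsilon> / 4\<close> on the deviation of the sample from its mean;
  \<open>\<epsilon> / 4\<close> on the empty diagonal squares of the step graphon.\<close>

lemma dense_systems_not_free:
  fixes H :: "('v, 'e) multigraph"
  assumes k: "1 \<le> k" and H: "loopless_multigraph H" and \<psi>: "rainbow_precoloring k H \<psi>"
    and s: "0 \<le> s" and \<epsilon>: "0 < \<epsilon>"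
    and bound: "\<And>W. admissible k W \<Longrightarrow> t_star k H \<psi> W = 0 \<Longrightarrow> Min ((\<lambda>l. t_K2 (W {l})) ` {1..k}) \<le> s"
  shows "\<exists>n0. \<forall>n\<ge>n0. \<forall>G. graph_system k {1..n} G \<longrightarrow> rainbow_free k {1..n} G H \<psi> \<longrightarrow>
    (\<exists>l\<in>{1..k}. real (card (G l)) \<le> (s + \<epsilon>) * real (n choose 2))"
proof -
  \<comment> \<open>The 2 keeps \<open>m - 1\<close> positive, the second term makes the
    \<open>k\<close> tail bounds sum to at most 1/2, and the third gives
    \<open>(s + \<epsilon> / 4) / m \<le> \<epsilon> / 4\<close> for the diagonal squares.\<close>
  define m where "m = nat \<lceil>2 + 256 * real k / \<epsilon>\<^sup>2 + (s + \<epsilon> / 4) * 4 / \<epsilon>\<rceil>"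
  have mge: "2 + 256 * real k / \<epsilon>\<^sup>2 + (s + \<epsilon> / 4) * 4 / \<epsilon> \<le> real m"
    unfolding m_def by linarith
  have q0: "0 \<le> 256 * real k / \<epsilon>\<^sup>2" "0 \<le> (s + \<epsilon> / 4) * 4 / \<epsilon>" using s \<epsilon> by auto
  have m2: "2 \<le> real m" and m_k: "256 * real k / \<epsilon>\<^sup>2 \<le> real m - 1"
    and m_s: "(s + \<epsilon> / 4) * 4 / \<epsilon> \<le> real m"
    using mge q0 by linarith+
  have m1: "1 \<le> m" using m2 by simp
  define b where "b = real (m choose 2)"
  have b: "b = real m * (real m - 1) / 2" by (simp add: b_def choose_2_real)
  have b0: "0 < b" using m2 by (simp add: b)
  have s_b: "s \<le> 2 * ((s + \<epsilon> / 4) * b) / (real m)\<^sup>2"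
  proof -
    have "2 * ((s + \<epsilon> / 4) * b) / (real m)\<^sup>2 = (s + \<epsilon> / 4) - (s + \<epsilon> / 4) / m"
      using m2 by (simp add: b power2_eq_square field_simps)
    moreover have "(s + \<epsilon> / 4) / m \<le> \<epsilon> / 4" using m_s m2 \<epsilon> by (simp add: field_simps)
    ultimately show ?thesis by linarith
  qed
  define V where "V = verts H"
  have finV: "finite V" and finE: "finite (edges H)" using H by (auto simp: V_def loopless_multigraph_def)
  define I where "I = (V \<rightarrow>\<^sub>E {1..m}) \<times> colorings k H \<psi>"
  have finI: "finite I" unfolding I_def using finV finE by (auto intro!: finite_PiE finite_colorings)
  \<comment> \<open>Probability at least 1/2 will be spread over \<open>card I\<close> patterns, so
    one of them exceeds \<open>c\<close>; the added 1 gives strictness and covers an empty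
    \<open>I\<close>. Note that \<open>c\<close> is fixed before \<open>n\<close>.\<close>
  define c where "c = 1 / (2 * (real (card I) + 1))"
  have c0: "0 < c" by (simp add: c_def)
  \<comment> \<open>The \<open>Inr\<close> coordinates carry the sample; the \<open>Inl\<close>
    coordinates, one per vertex of \<open>H\<close>, are the spares for the duplication.\<close>
  define X where "X = (Inl ` V \<union> Inr ` {1..m} :: ('v + nat) set)"
  define P where "P = (\<lambda>(i, j). (Inr i, Inr j) :: ('v + nat) \<times> ('v + nat)) ` up_pairs m"
  have finX: "finite X" unfolding X_def using finV by simp
  have injP: "inj_on (\<lambda>(i, j). (Inr i, Inr j) :: ('v + nat) \<times> ('v + nat)) (up_pairs m)"
    by (auto simp: inj_on_def)
  have cardP: "real (card P) = b" unfolding P_def by (simp add: card_image[OF injP] card_up_pairs b_def)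
  \<comment> \<open>The second term ensures
    \<open>(s + \<epsilon>) / n \<le> \<epsilon> / 2\<close>. The last one, strictly exceeded thanks
    to the 2, contradicts the bound on \<open>card N\<close> from
    \<open>rainbow_hom_density\<close>.\<close>
  define n0 where "n0 = nat \<lceil>2 + 2 * (s + \<epsilon>) / \<epsilon> + (real (card V))\<^sup>2 / c ^ 2 ^ card V\<rceil>"
  have "\<exists>l\<in>{1..k}. real (card (G l)) \<le> (s + \<epsilon>) * real (n choose 2)"
    if n: "n0 \<le> n" and G: "graph_system k {1..n} G" and free: "rainbow_free k {1..n} G H \<psi>" for n G
  proof (rule ccontr)
    assume "\<not> ?thesis"
    then have dense: "(s + \<epsilon>) * real (n choose 2) < real (card (G l))" if "l \<in> {1..k}" for l
      using that by (auto simp: not_le)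
    have nge: "2 + 2 * (s + \<epsilon>) / \<epsilon> + (real (card V))\<^sup>2 / c ^ 2 ^ card V \<le> real n"
      using n unfolding n0_def by linarith
    have q: "0 \<le> 2 * (s + \<epsilon>) / \<epsilon>" "0 \<le> (real (card V))\<^sup>2 / c ^ 2 ^ card V" using s \<epsilon> c0 by auto
    have n2: "2 \<le> real n" and n_s: "2 * (s + \<epsilon>) / \<epsilon> \<le> real n" 
      and n_c: "(real (card V))\<^sup>2 / c ^ 2 ^ card V < real n" using nge q by linarith+
    define N where "N = {1..n}"
    have N: "finite N" "N \<noteq> {}" "card N = n" using n2 by (auto simp: N_def)
    interpret prob_space "uniform_count_measure N"
      using N by (intro prob_space_uniform_count_measure)
    define f :: "nat \<Rightarrow> nat \<times> nat \<Rightarrow> real" where "f l = (\<lambda>(a, b). of_bool ({a, b} \<in> G l))" for l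
    define t where "t l = (\<integral>z. f l z \<partial>(uniform_count_measure N \<Otimes>\<^sub>M uniform_count_measure N))" for l
    have t: "s + \<epsilon> / 2 \<le> t l" if l: "l \<in> {1..k}" for l
    proof -
      have "(\<Sum>z\<in>N \<times> N. f l z) = real (card {(i, j). i \<in> N \<and> j \<in> N \<and> {i, j} \<in> G l})"
        using N by (simp add: f_def case_prod_unfold Int_def mem_Times_iff conj_assoc)
      also have "\<dots> = 2 * real (card (G l))"
        using card_ordered_edges[of N "G l"] G l by (auto simp: graph_system_def N_def)
      finally have "t l = 2 * real (card (G l)) / (real n)\<^sup>2"
        unfolding t_def by (simp add: integral_uniform_pair(2)[OF N(1,2)] N(3))
      also have "\<dots> \<ge> 2 * ((s + \<epsilon>) * real (n choose 2)) / (real n)\<^sup>2"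
        using dense[OF l] by (intro divide_right_mono) auto
      also have "2 * ((s + \<epsilon>) * real (n choose 2)) / (real n)\<^sup>2 = (s + \<epsilon>) - (s + \<epsilon>) / n"
        using n2 by (simp add: choose_2_real power2_eq_square field_simps)
      finally have "(s + \<epsilon>) - (s + \<epsilon>) / n \<le> t l" .
      moreover have "(s + \<epsilon>) / n \<le> \<epsilon> / 2" using n_s n2 \<epsilon> by (simp add: field_simps)
      ultimately show ?thesis by linarith
    qed
    define PM where "PM = (\<Pi>\<^sub>M i\<in>X. uniform_count_measure N)"
    have PM: "PM = uniform_count_measure (X \<rightarrow>\<^sub>E N)"
      unfolding PM_def by (rule PiM_uniform_count_measure[OF finX N(1,2)])
    interpret PM: prob_space PM unfolding PM_def by (intro prob_space_PiM prob_space_axioms)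
    have finXN: "finite (X \<rightarrow>\<^sub>E N)" using finX N by (simp add: finite_PiE)
    have sp: "space PM = X \<rightarrow>\<^sub>E N" "sets PM = Pow (X \<rightarrow>\<^sub>E N)"
      unfolding PM by (simp_all add: space_uniform_count_measure sets_uniform_count_measure)
    define bad where "bad l = {x \<in> X \<rightarrow>\<^sub>E N. (\<Sum>(a, b)\<in>P. f l (x a, x b)) \<le> t l * card P - \<epsilon> / 4 * b}" for l
    define hom where "hom = (\<lambda>(a, \<rho>). {x \<in> X \<rightarrow>\<^sub>E N. rainbow_hom H G \<rho> (x \<circ> Inr \<circ> a)})"
    have bad: "PM.prob (bad l) \<le> 128 / (\<epsilon>\<^sup>2 * (real m - 1))" for l
    proof -
      have "PM.prob (bad l) \<le> 4 * real (card (Inr ` {1..m} :: ('v + nat) set)) * card P / (\<epsilon> / 4 * b)\<^sup>2"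
        unfolding bad_def t_def sp(1)[symmetric] PM_def
      proof (rule edge_sum_concentration(2))
        show "finite (Inr ` {1..m} :: ('v + nat) set)" "Inr ` {1..m} \<subseteq> X" "P \<subseteq> Inr ` {1..m} \<times> Inr ` {1..m}"
          "\<And>x y. (x, y) \<in> P \<Longrightarrow> x \<noteq> y" "0 < \<epsilon> / 4 * b"
          using b0 \<epsilon> by (auto simp: X_def P_def up_pairs_def)
        show "f l \<in> borel_measurable (uniform_count_measure N \<Otimes>\<^sub>M uniform_count_measure N)"
          by (rule integral_uniform_pair(1)[OF N(1,2)])
      qed (auto simp: f_def)
      also have "\<dots> = 128 / (\<epsilon>\<^sup>2 * (real m - 1))"
      proof -
        define r where "r = real m - 1"
        have "0 < r" "0 < real m" "b = real m * r / 2" using m2 by (auto simp: r_def b)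
        then show ?thesis
          unfolding cardP r_def[symmetric] using \<epsilon> b0 by (simp add: card_image power2_eq_square field_simps)
      qed
      finally show ?thesis .
    qed
    \<comment> \<open>Outside the bad events the sample is dense in every colour, and its step
      graphon supplies a pattern \<open>a\<close> and a coloring \<open>\<rho>\<close>.\<close>
    have "space PM \<subseteq> (\<Union>l\<in>{1..k}. bad l) \<union> (\<Union>i\<in>I. hom i)"
    proof
      fix x assume x: "x \<in> space PM"
      show "x \<in> (\<Union>l\<in>{1..k}. bad l) \<union> (\<Union>i\<in>I. hom i)"
      proof (cases "x \<in> (\<Union>l\<in>{1..k}. bad l)")
        case False
        have "\<exists>\<rho>\<in>colorings k H \<psi>. \<exists>a\<in>verts H \<rightarrow>\<^sub>E {1..m}. rainbow_hom H G \<rho> ((x \<circ> Inr) \<circ> a)"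
        proof (rule induced_system_hom[OF k H m1 bound])
          fix l assume l: "l \<in> {1..k}"
          have "(\<Sum>(i, j)\<in>up_pairs m. of_bool ({(x \<circ> Inr) i, (x \<circ> Inr) j} \<in> G l)) = (\<Sum>(a, b)\<in>P. f l (x a, x b))"
            unfolding P_def by (subst sum.reindex[OF injP]) (simp add: f_def case_prod_unfold)
          also have "\<dots> > t l * b - \<epsilon> / 4 * b"
            using False l x by (auto simp: bad_def sp cardP not_le)
          moreover have "(s + \<epsilon> / 2) * b \<le> t l * b" using t[OF l] b0 by (intro mult_right_mono) auto
          ultimately have "(s + \<epsilon> / 4) * b < (\<Sum>(i, j)\<in>up_pairs m. of_bool ({(x \<circ> Inr) i, (x \<circ> Inr) j} \<in> G l))"
            by (simp add: algebra_simps)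
          then have "2 * ((s + \<epsilon> / 4) * b) / (real m)\<^sup>2 <
              2 * (\<Sum>(i, j)\<in>up_pairs m. of_bool ({(x \<circ> Inr) i, (x \<circ> Inr) j} \<in> G l)) / (real m)\<^sup>2"
            using m2 by (intro divide_strict_right_mono) auto
          then show "s < 2 * (\<Sum>(i, j)\<in>up_pairs m. of_bool ({(x \<circ> Inr) i, (x \<circ> Inr) j} \<in> G l)) / (real m)\<^sup>2"
            using s_b by linarith
        qed
        then show ?thesis using x by (auto simp: I_def hom_def sp V_def o_assoc)
      qed simp
    qed
    then have "1 \<le> PM.prob ((\<Union>l\<in>{1..k}. bad l) \<union> (\<Union>i\<in>I. hom i))"
      by (subst PM.prob_space[symmetric], intro PM.finite_measure_mono) (auto simp: sp bad_def hom_def)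
    also have "\<dots> \<le> PM.prob (\<Union>l\<in>{1..k}. bad l) + PM.prob (\<Union>i\<in>I. hom i)"
      by (intro measure_Un_le) (auto simp: sp bad_def hom_def)
    also have "\<dots> \<le> (\<Sum>l\<in>{1..k}. PM.prob (bad l)) + (\<Sum>i\<in>I. PM.prob (hom i))"
      using finI by (intro add_mono PM.finite_measure_subadditive_finite) (auto simp: sp bad_def hom_def)
    also have "(\<Sum>l\<in>{1..k}. PM.prob (bad l)) \<le> (\<Sum>l\<in>{1..k}. 128 / (\<epsilon>\<^sup>2 * (real m - 1)))"
      by (intro sum_mono bad)
    also have "\<dots> \<le> 1 / 2"
      using m_k m2 \<epsilon> by (simp add: field_simps)
    finally have "1 / 2 \<le> (\<Sum>i\<in>I. PM.prob (hom i))" by simp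
    moreover have "(\<Sum>i\<in>I. PM.prob (hom i)) \<le> (\<Sum>i\<in>I. c)" if "\<And>i. i \<in> I \<Longrightarrow> PM.prob (hom i) \<le> c"
      using that by (intro sum_mono)
    moreover have "(\<Sum>i\<in>I. c) < 1 / 2" by (simp add: c_def field_simps)
    ultimately obtain i where i: "i \<in> I" "c < PM.prob (hom i)" by (meson not_le order_trans leD)
    obtain a \<rho> where a\<rho>: "i = (a, \<rho>)" by force
    have prob: "PM.prob (hom i) = card (hom i) / card N ^ card X"
      unfolding PM using finXN finX by (subst measure_uniform_count_measure) (auto simp: hom_def a\<rho> card_PiE)
    have "c * card N ^ card X \<le> card {x \<in> X \<rightarrow>\<^sub>E N. rainbow_hom H G \<rho> (x \<circ> Inr \<circ> a)}"
      using i(2) n2 N(3) unfolding prob by (simp add: hom_def a\<rho> field_simps)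
    then have "c ^ 2 ^ card (verts H) * card N \<le> (real (card (verts H)))\<^sup>2"
    proof (intro rainbow_hom_density[OF H, of k N G \<rho> \<psi> X a])
      show "\<not> rainbow_hom H G \<rho> g" if "inj_on g (verts H)" "g ` verts H \<subseteq> N" for g
        using free i(1) that unfolding rainbow_free_iff[OF H \<psi> G] by (auto simp: a\<rho> I_def N_def)
    qed (use i(1) G c0 N finX in \<open>auto simp: a\<rho> I_def X_def V_def N_def\<close>)
    then show False using n_c c0 N(3) by (simp add: V_def field_simps)
  qed
  then show ?thesis by blast
qed

section \<open>Rainbow-free systems from graphons\<close>

text \<open>The integrand is measurable with values in \<open>[0, 1]\<close>, hence integrable; only
  then does a vanishing integral of a nonnegative function force it to be zero almost
  everywhere.\<close>

lemma
  assumes W: "graphon_system k W" and H: "loopless_multigraph H"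
    and \<rho>: "\<rho> \<in> colorings k H \<psi>"
  defines "F \<equiv> \<lambda>x. \<Prod>p\<in>{p. p \<subseteq> verts H \<and> card p = 2}.
    pair_value (W (\<rho> ` {e \<in> edges H. ends H e = p})) x p"
  shows t_coloring_nonneg: "0 \<le> t_coloring H \<rho> W"
    and AE_t_coloring_zero: "t_coloring H \<rho> W = 0 \<Longrightarrow> AE x in (\<Pi>\<^sub>M v\<in>verts H. unit_measure). F x = 0"
proof -
  let ?P = "\<Pi>\<^sub>M v\<in>verts H. unit_measure"
  interpret P: prob_space ?P by (intro prob_space_PiM unit_measure.prob_space_axioms)
  define Wp where "Wp p = W (\<rho> ` {e \<in> edges H. ends H e = p})" for p
  have gr: "graphon (Wp p)" for p
  proof -
    have "\<rho> ` {e \<in> edges H. ends H e = p} \<subseteq> {1..k}" using \<rho> by (auto simp: colorings_def)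
    then show ?thesis using W by (simp add: graphon_system_def Wp_def)
  qed
  have meas: "(\<lambda>x. pair_value (Wp p) x p) \<in> borel_measurable ?P"
    and bd: "x \<in> space ?P \<Longrightarrow> 0 \<le> pair_value (Wp p) x p \<and> pair_value (Wp p) x p \<le> 1"
    if p: "p \<subseteq> verts H" "card p = 2" for p x
  proof -
    obtain u v where uv: "p = {u, v}" "u \<noteq> v" using p by (auto simp: card_2_iff)
    have in01: "x u \<in> {0..1}" "x v \<in> {0..1}" if "x \<in> space ?P" for x
      using that p by (auto simp: space_PiM PiE_iff uv)
    have eq: "pair_value (Wp p) x p = Wp p (x u, x v)" if "x \<in> space ?P" for x
      unfolding uv(1) using gr[of "{u, v}"] in01[OF that]
      by (intro pair_value_doubleton) (auto simp: graphon_def)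
    have "(\<lambda>x. Wp p (x u, x v)) \<in> borel_measurable ?P"
      using gr p uv by (intro unit_measure.measurable_PiM_pair) (auto simp: graphon_def)
    then show "(\<lambda>x. pair_value (Wp p) x p) \<in> borel_measurable ?P"
      by (subst measurable_cong[OF eq])
    show "x \<in> space ?P \<Longrightarrow> 0 \<le> pair_value (Wp p) x p \<and> pair_value (Wp p) x p \<le> 1"
      using gr[of p] in01[of x] by (auto simp: eq graphon_def)
  qed
  have F: "F = (\<lambda>x. \<Prod>p\<in>{p. p \<subseteq> verts H \<and> card p = 2}. pair_value (Wp p) x p)"
    by (simp add: F_def Wp_def)
  have Fm: "F \<in> borel_measurable ?P" unfolding F by (intro borel_measurable_prod meas) auto
  have F0: "0 \<le> F x" and F1: "F x \<le> 1" if "x \<in> space ?P" for x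
    unfolding F using bd that by (auto intro!: prod_nonneg prod_le_1)
  have int: "integrable ?P F"
    by (rule P.integrable_const_bound[of _ 1]) (use F0 F1 Fm in \<open>auto intro!: AE_I2\<close>)
  have t: "t_coloring H \<rho> W = (\<integral>x. F x \<partial>?P)" by (simp add: t_coloring_def F_def)
  show "0 \<le> t_coloring H \<rho> W" unfolding t using F0 by (intro integral_nonneg_AE AE_I2)
  show "t_coloring H \<rho> W = 0 \<Longrightarrow> AE x in ?P. F x = 0"
    unfolding t by (subst (asm) integral_nonneg_eq_0_iff_AE[OF int]) (use F0 in \<open>auto intro!: AE_I2\<close>)
qed

text \<open>Coordinates at distinct indices of a product sample form a product sample again, so a
  null event for the vertices of \<open>H\<close> pulls back to one for the \<open>n\<close> points.
  Repeated indices would land on a diagonal, itself possibly null.\<close>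

lemma AE_PiM_injection:
  assumes "prob_space M" "inj_on \<phi> V" "\<phi> \<in> V \<rightarrow> X" and AE: "AE y in (\<Pi>\<^sub>M v\<in>V. M). Q y"
  shows "AE x in (\<Pi>\<^sub>M i\<in>X. M). Q (\<lambda>v\<in>V. x (\<phi> v))"
proof (rule AE_distrD[where M' = "\<Pi>\<^sub>M v\<in>V. M"])
  show "(\<lambda>x. \<lambda>v\<in>V. x (\<phi> v)) \<in> measurable (\<Pi>\<^sub>M i\<in>X. M) (\<Pi>\<^sub>M v\<in>V. M)"
    using assms(3) by (intro measurable_restrict measurable_component_singleton) auto
  show "AE y in distr (\<Pi>\<^sub>M i\<in>X. M) (\<Pi>\<^sub>M v\<in>V. M) (\<lambda>x. \<lambda>v\<in>V. x (\<phi> v)). Q y"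
  proof -
    have "distr (\<Pi>\<^sub>M i\<in>X. M) (\<Pi>\<^sub>M v\<in>V. M) (\<lambda>x. \<lambda>v\<in>V. x (\<phi> v)) = (\<Pi>\<^sub>M v\<in>V. M)"
      using distr_PiM_reindex[of X "\<lambda>_. M" \<phi> V] assms by simp
    then show ?thesis using AE by (simp only:)
  qed
qed

lemma AE_PiM_pair:
  assumes "prob_space M" "a \<in> X" "b \<in> X" "a \<noteq> b" and AE: "AE z in M \<Otimes>\<^sub>M M. Q z"
  shows "AE x in (\<Pi>\<^sub>M i\<in>X. M). Q (x a, x b)"
proof (rule AE_distrD[where M' = "M \<Otimes>\<^sub>M M"])
  show "(\<lambda>x. (x a, x b)) \<in> measurable (\<Pi>\<^sub>M i\<in>X. M) (M \<Otimes>\<^sub>M M)"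
    using assms by (intro measurable_Pair measurable_component_singleton)
  show "AE z in distr (\<Pi>\<^sub>M i\<in>X. M) (M \<Otimes>\<^sub>M M) (\<lambda>x. (x a, x b)). Q z"
    using AE by (simp only: prob_space.distr_PiM_pair[OF assms(1-4)])
qed

text \<open>In a rainbow copy, the colours used on a pair form a subset \<open>I\<close> of its
  chosen set, so \<open>W I\<close> is at least the positive overlined weight of that set. Then
  every factor of the integrand is positive, against \<open>zero\<close>.\<close>

lemma rounded_system_free:
  fixes H :: "('v, 'e) multigraph"
  assumes H: "loopless_multigraph H" and \<psi>: "rainbow_precoloring k H \<psi>"
    and W: "graphon_system k W" and x: "\<And>i. i \<in> {1..n} \<Longrightarrow> x i \<in> {0..1}"
    and nonneg: "\<And>i j I. (i, j) \<in> up_pairs n \<Longrightarrow> I \<subseteq> {1..k} \<Longrightarrow> 0 \<le> overline_system k W I (x i, x j)"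
    and pos: "\<And>i j. (i, j) \<in> up_pairs n \<Longrightarrow> c (i, j) \<subseteq> {1..k} \<and> 0 < overline_system k W (c (i, j)) (x i, x j)"
    and zero: "\<And>\<phi> \<rho>. \<phi> \<in> verts H \<rightarrow>\<^sub>E {1..n} \<Longrightarrow> inj_on \<phi> (verts H) \<Longrightarrow> \<rho> \<in> colorings k H \<psi> \<Longrightarrow>
      (\<Prod>p\<in>{p. p \<subseteq> verts H \<and> card p = 2}.
        pair_value (W (\<rho> ` {e \<in> edges H. ends H e = p})) (\<lambda>v\<in>verts H. x (\<phi> v)) p) = 0"
  defines "G \<equiv> \<lambda>l. (\<lambda>(i, j). {i, j}) ` {p \<in> up_pairs n. l \<in> c p}"
  shows "graph_system k {1..n} G \<and> rainbow_free k {1..n} G H \<psi>"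
proof
  show gs: "graph_system k {1..n} G"
    by (auto simp: graph_system_def G_def up_pairs_def card_2_iff)
  have finV: "finite (verts H)" using H by (auto simp: loopless_multigraph_def)
  have "False" if \<rho>: "\<rho> \<in> colorings k H \<psi>" and inj: "inj_on g (verts H)" 
    and g: "g ` verts H \<subseteq> {1..n}" and hom: "rainbow_hom H G \<rho> g" for \<rho> g
  proof -
    define \<phi> where "\<phi> = restrict g (verts H)"
    have \<phi>: "\<phi> \<in> verts H \<rightarrow>\<^sub>E {1..n}" "inj_on \<phi> (verts H)"
      using g inj by (auto simp: \<phi>_def inj_on_restrict_eq)
    obtain p where p: "p \<subseteq> verts H" "card p = 2"
      and p0: "pair_value (W (\<rho> ` {e \<in> edges H. ends H e = p})) (\<lambda>v\<in>verts H. x (\<phi> v)) p = 0"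
    proof -
      have "finite {p. p \<subseteq> verts H \<and> card p = 2}" using finV by simp
      from iffD1[OF prod_zero_iff[OF this] zero[OF \<phi> \<rho>]] show ?thesis using that by blast
    qed
    \<comment> \<open>The weights were rounded at \<open>(x i, x j)\<close> with
      \<open>i < j\<close>, so the pair is oriented the same way; symmetry of \<open>W\<close> makes
      this harmless.\<close>
    obtain u v where uv: "p = {u, v}" "u \<in> verts H" "v \<in> verts H" "g u < g v"
    proof -
      obtain u v where *: "p = {u, v}" "u \<noteq> v" using p by (auto simp: card_2_iff)
      then have "g u \<noteq> g v" using inj p by (auto simp: inj_on_def)
      then consider "g u < g v" | "g v < g u" by linarith
      then show ?thesis using that[of u v] that[of v u] * p by cases (auto simp: insert_commute)
    qed
    have up: "(g u, g v) \<in> up_pairs n" using uv g by (auto simp: up_pairs_def)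
    have x01: "x (g u) \<in> {0..1}" "x (g v) \<in> {0..1}" using x g uv by auto
    define I where "I = \<rho> ` {e \<in> edges H. ends H e = p}"
    have I: "I \<subseteq> {1..k}" using \<rho> by (auto simp: I_def colorings_def)
    have "W I (x (g u), x (g v)) = W I (x (g v), x (g u))"
      using W I x01 unfolding graphon_system_def graphon_def by blast
    then have "pair_value (W I) (\<lambda>v\<in>verts H. x (\<phi> v)) p = W I (x (g u), x (g v))"
      unfolding uv(1) using uv(2,3) by (subst pair_value_doubleton) (auto simp: \<phi>_def)
    then have W0: "W I (x (g u), x (g v)) = 0" using p0 by (simp add: I_def)
    have "I \<subseteq> c (g u, g v)"
    proof
      fix l assume "l \<in> I"
      then obtain e where e: "e \<in> edges H" "ends H e = p" "l = \<rho> e" by (auto simp: I_def)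
      then have "{g u, g v} \<in> G l" using hom by (auto simp: rainbow_hom_def uv)
      then obtain i j where "(i, j) \<in> up_pairs n" "l \<in> c (i, j)" "{g u, g v} = {i, j}"
        by (auto simp: G_def)
      then show "l \<in> c (g u, g v)" using uv(4) by (auto simp: up_pairs_def doubleton_eq_iff)
    qed
    moreover have "finite {J. I \<subseteq> J \<and> J \<subseteq> {1..k}}"
      by (rule finite_subset[of _ "Pow {1..k}"]) auto
    ultimately have "0 < (\<Sum>J\<in>{J. I \<subseteq> J \<and> J \<subseteq> {1..k}}. overline_system k W J (x (g u), x (g v)))"
      using pos[OF up] nonneg[OF up] by (intro sum_pos2[of _ "c (g u, g v)"]) auto
    then show False using W0 overline_system_sum[OF I, of W "(x (g u), x (g v))"] by linarith
  qed
  then show "rainbow_free k {1..n} G H \<psi>" unfolding rainbow_free_iff[OF H \<psi> gs] by blast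
qed

lemma graphon_free_systems:
  fixes H :: "('v, 'e) multigraph"
  assumes H: "loopless_multigraph H" and \<psi>: "rainbow_precoloring k H \<psi>"
    and W: "admissible k W" and tW: "t_star k H \<psi> W = 0" and \<epsilon>: "0 < \<epsilon>"
  shows "\<exists>n0. \<forall>n\<ge>n0. \<exists>G. graph_system k {1..n} G \<and> rainbow_free k {1..n} G H \<psi> \<and>
    (\<forall>l\<in>{1..k}. (t_K2 (W {l}) - \<epsilon>) * real (n choose 2) \<le> real (card (G l)))"
proof -
  \<comment> \<open>One constant serves twice: it makes the \<open>k\<close> tail bounds
    \<open>32 / (\<epsilon>\<^sup>2 * r)\<close> sum to at most 1/2, and it gives
    \<open>4 * k \<le> b * \<epsilon>\<^sup>2\<close>, which bounds the rounding error.\<close>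
  define n0 where "n0 = nat \<lceil>2 + 64 * real k / \<epsilon>\<^sup>2\<rceil>"
  have gs: "graphon_system k W" using W by (simp add: admissible_def)
  have gr: "graphon (W {l})" if "l \<in> {1..k}" for l using gs that by (simp add: graphon_system_def)
  have "\<exists>G. graph_system k {1..n} G \<and> rainbow_free k {1..n} G H \<psi> \<and>
    (\<forall>l\<in>{1..k}. (t_K2 (W {l}) - \<epsilon>) * real (n choose 2) \<le> real (card (G l)))"
    if n: "n0 \<le> n" for n
  proof -
    have nge: "2 + 64 * real k / \<epsilon>\<^sup>2 \<le> real n" using n unfolding n0_def by linarith
    have "0 \<le> 64 * real k / \<epsilon>\<^sup>2" by simp
    then have n2: "2 \<le> real n" and n_k: "64 * real k / \<epsilon>\<^sup>2 \<le> real n - 1" using nge by linarith+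
    define b where "b = real (n choose 2)"
    define r where "r = real n - 1"
    have b: "b = real n * r / 2" by (simp add: b_def choose_2_real r_def)
    have r0: "0 < r" and r_k: "64 * real k \<le> r * \<epsilon>\<^sup>2" using n2 n_k \<epsilon> by (auto simp: r_def field_simps)
    have b0: "0 < b" using n2 r0 by (simp add: b)
    have rb: "r \<le> b" using n2 r0 by (simp add: b field_simps)
    let ?M = "\<Pi>\<^sub>M i\<in>{1..n}. unit_measure"
    interpret M: prob_space ?M by (intro prob_space_PiM unit_measure.prob_space_axioms)
    define bad where "bad l = {x \<in> space ?M.
      (\<Sum>(i, j)\<in>up_pairs n. W {l} (x i, x j)) \<le> t_K2 (W {l}) * card (up_pairs n) - \<epsilon> / 2 * b}" for l
    have bad: "bad l \<in> sets ?M" "M.prob (bad l) \<le> 32 / (\<epsilon>\<^sup>2 * r)" if l: "l \<in> {1..k}" for l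
    proof -
      have "W {l} \<in> borel_measurable (unit_measure \<Otimes>\<^sub>M unit_measure)" using gr[OF l] by (simp add: graphon_def)
      moreover have "0 \<le> W {l} z \<and> W {l} z \<le> 1" if "z \<in> space (unit_measure \<Otimes>\<^sub>M unit_measure)" for z
        using gr[OF l] that by (auto simp: graphon_def space_unit_square)
      moreover have "up_pairs n \<subseteq> {1..n} \<times> {1..n}" "\<And>i j. (i, j) \<in> up_pairs n \<Longrightarrow> i \<noteq> j"
        by (auto simp: up_pairs_def)
      ultimately have *: "bad l \<in> sets ?M"
        "M.prob (bad l) \<le> 4 * real (card {1..n}) * real (card (up_pairs n)) / (\<epsilon> / 2 * b)\<^sup>2"
        unfolding bad_def t_K2_def
        by (intro unit_measure.edge_sum_concentration[where T = "{1..n}"]; use b0 \<epsilon> in simp)+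
      show "bad l \<in> sets ?M" by (rule *(1))
      have "4 * real (card {1..n}) * real (card (up_pairs n)) / (\<epsilon> / 2 * b)\<^sup>2 = 32 / (\<epsilon>\<^sup>2 * r)"
        unfolding card_up_pairs b_def[symmetric] using n2 r0 \<epsilon> by (simp add: b power2_eq_square field_simps)
      then show "M.prob (bad l) \<le> 32 / (\<epsilon>\<^sup>2 * r)" using *(2) by simp
    qed
    have "M.prob (\<Union>l\<in>{1..k}. bad l) \<le> (\<Sum>l\<in>{1..k}. M.prob (bad l))"
      using bad(1) by (intro M.finite_measure_subadditive_finite) auto
    also have "\<dots> \<le> (\<Sum>l\<in>{1..k}. 32 / (\<epsilon>\<^sup>2 * r))" by (intro sum_mono bad)
    also have "\<dots> \<le> 1 / 2" using r_k r0 \<epsilon> by (simp add: field_simps)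
    finally have "M.prob (\<Union>l\<in>{1..k}. bad l) < 1" by simp
    then have not_AE_bad: "\<not> (AE x in ?M. x \<in> (\<Union>l\<in>{1..k}. bad l))"
      using bad(1) by (subst M.AE_in_set_eq_1) auto
    have nonneg: "AE x in ?M. \<forall>p\<in>up_pairs n. \<forall>I\<in>Pow {1..k}. 0 \<le> overline_system k W I (x (fst p), x (snd p))"
    proof (intro AE_finite_allI)
      fix p I assume "p \<in> up_pairs n" "I \<in> Pow {1..k}"
      then show "AE x in ?M. 0 \<le> overline_system k W I (x (fst p), x (snd p))"
        using W unfolding admissible_def
        by (intro AE_PiM_pair[OF unit_measure.prob_space_axioms]) (auto simp: up_pairs_def)
    qed auto
    have fin: "finite (edges H)" "finite (verts H)" using H by (auto simp: loopless_multigraph_def)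
    have zero: "t_coloring H \<rho> W = 0" if "\<rho> \<in> colorings k H \<psi>" for \<rho>
      using tW that t_coloring_nonneg[OF gs H] finite_colorings[OF fin(1)]
      unfolding t_star_def colorings_def[symmetric] by (simp add: sum_nonneg_eq_0_iff)
    have null: "AE x in ?M. \<forall>\<phi>\<in>{\<phi> \<in> verts H \<rightarrow>\<^sub>E {1..n}. inj_on \<phi> (verts H)}. \<forall>\<rho>\<in>colorings k H \<psi>.
      (\<Prod>p\<in>{p. p \<subseteq> verts H \<and> card p = 2}.
        pair_value (W (\<rho> ` {e \<in> edges H. ends H e = p})) (\<lambda>v\<in>verts H. x (\<phi> v)) p) = 0"
    proof (intro AE_finite_allI)
      fix \<phi> \<rho> assume \<phi>: "\<phi> \<in> {\<phi> \<in> verts H \<rightarrow>\<^sub>E {1..n}. inj_on \<phi> (verts H)}" and \<rho>: "\<rho> \<in> colorings k H \<psi>"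
      show "AE x in ?M. (\<Prod>p\<in>{p. p \<subseteq> verts H \<and> card p = 2}.
          pair_value (W (\<rho> ` {e \<in> edges H. ends H e = p})) (\<lambda>v\<in>verts H. x (\<phi> v)) p) = 0"
        by (rule AE_PiM_injection[OF unit_measure.prob_space_axioms _ _ AE_t_coloring_zero[OF gs H \<rho>]])
          (use \<phi> zero[OF \<rho>] in \<open>auto simp: PiE_iff\<close>)
    qed (use fin in \<open>auto simp: finite_PiE finite_colorings\<close>)
    define generic where "generic x \<longleftrightarrow>
      (\<forall>p\<in>up_pairs n. \<forall>I\<in>Pow {1..k}. 0 \<le> overline_system k W I (x (fst p), x (snd p))) \<and>
      (\<forall>\<phi>\<in>{\<phi> \<in> verts H \<rightarrow>\<^sub>E {1..n}. inj_on \<phi> (verts H)}. \<forall>\<rho>\<in>colorings k H \<psi>.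
        (\<Prod>p\<in>{p. p \<subseteq> verts H \<and> card p = 2}.
          pair_value (W (\<rho> ` {e \<in> edges H. ends H e = p})) (\<lambda>v\<in>verts H. x (\<phi> v)) p) = 0)" for x
    have generic: "AE x in ?M. generic x"
      unfolding generic_def using nonneg null by (rule AE_conjI)
    \<comment> \<open>If all generic points were bad, the bad event would be almost sure, but its
      probability is at most 1/2.\<close>
    have "\<exists>x\<in>space ?M. generic x \<and> x \<notin> (\<Union>l\<in>{1..k}. bad l)"
    proof (rule ccontr)
      assume "\<not> ?thesis"
      then have "AE x in ?M. generic x \<longrightarrow> x \<in> (\<Union>l\<in>{1..k}. bad l)" by (intro AE_I2) blast
      with generic have "AE x in ?M. x \<in> (\<Union>l\<in>{1..k}. bad l)" by (rule AE_mp)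
      then show False using not_AE_bad by simp
    qed
    then obtain x where x: "x \<in> space ?M" "generic x" "x \<notin> (\<Union>l\<in>{1..k}. bad l)" by blast
    define q where "q p I = overline_system k W I (x (fst p), x (snd p))" for p I
    have x01: "x i \<in> {0..1}" if "i \<in> {1..n}" for i using x(1) that by (auto simp: space_PiM PiE_iff)
    have x01': "x (fst p) \<in> {0..1}" "x (snd p) \<in> {0..1}" if "p \<in> up_pairs n" for p
    proof -
      have "fst p \<in> {1..n}" "snd p \<in> {1..n}" using that by (auto simp: up_pairs_def)
      then show "x (fst p) \<in> {0..1}" "x (snd p) \<in> {0..1}" using x01 by blast+
    qed
    \<comment> \<open>The total weight is the value of \<open>W {}\<close>, so the normalization of
      graphon systems supplies the probability weights.\<close>
    have q1: "(\<Sum>I\<in>Pow {1..k}. q p I) = 1" if "p \<in> up_pairs n" for p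
    proof -
      have "{J. {} \<subseteq> J \<and> J \<subseteq> {1..k}} = Pow {1..k}" by auto
      then have "(\<Sum>I\<in>Pow {1..k}. q p I) = W {} (x (fst p), x (snd p))"
        using overline_system_sum[of "{}" k W "(x (fst p), x (snd p))"] by (simp only: q_def empty_subsetI)
      also have "\<dots> = 1" using gs x01'[OF that] unfolding graphon_system_def by blast
      finally show ?thesis .
    qed
    have ql: "(\<Sum>I\<in>{I \<in> Pow {1..k}. l \<in> I}. q p I) = W {l} (x (fst p), x (snd p))"
      if "l \<in> {1..k}" for p l
    proof -
      have "{J. {l} \<subseteq> J \<and> J \<subseteq> {1..k}} = {I \<in> Pow {1..k}. l \<in> I}" by auto
      moreover have "{l} \<subseteq> {1..k}" using that by simp
      ultimately show ?thesis
        using overline_system_sum[of "{l}" k W "(x (fst p), x (snd p))"] by (simp only: q_def)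
    qed
    have q0: "0 \<le> q p I" if "p \<in> up_pairs n" "I \<subseteq> {1..k}" for p I
      using x(2) that unfolding generic_def q_def by blast
    obtain c where c_dev: "(\<forall>p\<in>up_pairs n. c p \<subseteq> {1..k} \<and> 0 < q p (c p)) \<and>
        (\<Sum>l\<in>{1..k}. (\<Sum>p\<in>up_pairs n. of_bool (l \<in> c p) - (\<Sum>I\<in>{I \<in> Pow {1..k}. l \<in> I}. q p I))\<^sup>2)
        \<le> real (card {1..k} * card (up_pairs n))"
      using simultaneous_rounding[OF finite_atLeastAtMost finite_up_pairs q0 q1] by (rule exE)
    note c = conjunct1[OF c_dev] and dev = conjunct2[OF c_dev]
    define G where "G l = (\<lambda>(i, j). {i, j}) ` {p \<in> up_pairs n. l \<in> c p}" for l
    have "graph_system k {1..n} G \<and> rainbow_free k {1..n} G H \<psi>"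
      unfolding G_def
    proof (rule rounded_system_free[OF H \<psi> gs x01])
      show "0 \<le> overline_system k W I (x i, x j)" if "(i, j) \<in> up_pairs n" "I \<subseteq> {1..k}" for i j I
        using q0[OF that] by (simp add: q_def)
      show "c (i, j) \<subseteq> {1..k} \<and> 0 < overline_system k W (c (i, j)) (x i, x j)" if "(i, j) \<in> up_pairs n" for i j
        using bspec[OF c that] by (simp add: q_def)
      fix \<phi> \<rho> assume "\<phi> \<in> verts H \<rightarrow>\<^sub>E {1..n}" "inj_on \<phi> (verts H)" and \<rho>: "\<rho> \<in> colorings k H \<psi>"
      then have "\<phi> \<in> {\<phi> \<in> verts H \<rightarrow>\<^sub>E {1..n}. inj_on \<phi> (verts H)}" by simp
      from bspec[OF bspec[OF conjunct2[OF x(2)[unfolded generic_def]] this] \<rho>]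
      show "(\<Prod>p\<in>{p. p \<subseteq> verts H \<and> card p = 2}.
        pair_value (W (\<rho> ` {e \<in> edges H. ends H e = p})) (\<lambda>v\<in>verts H. x (\<phi> v)) p) = 0" .
    qed
    moreover have "(t_K2 (W {l}) - \<epsilon>) * real (n choose 2) \<le> real (card (G l))" if l: "l \<in> {1..k}" for l
    proof -
      define S where "S = (\<Sum>p\<in>up_pairs n. W {l} (x (fst p), x (snd p)))"
      have "inj_on (\<lambda>(i, j). {i, j}) {p \<in> up_pairs n. l \<in> c p}"
        by (rule inj_on_subset[OF bij_betw_imp_inj_on[OF bij_betw_up_pairs[of n]]]) auto
      then have "real (card (G l)) = (\<Sum>p\<in>up_pairs n. of_bool (l \<in> c p))"
        by (simp add: G_def card_image Int_def)
      then have eq: "(\<Sum>p\<in>up_pairs n. of_bool (l \<in> c p) - (\<Sum>I\<in>{I \<in> Pow {1..k}. l \<in> I}. q p I)) = real (card (G l)) - S"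
        by (simp only: ql[OF l] sum_subtractf S_def)
      have "(real (card (G l)) - S)\<^sup>2 \<le> (\<Sum>l\<in>{1..k}. (\<Sum>p\<in>up_pairs n. of_bool (l \<in> c p) - (\<Sum>I\<in>{I \<in> Pow {1..k}. l \<in> I}. q p I))\<^sup>2)"
        unfolding eq[symmetric] using l by (intro member_le_sum) auto
      also note dev
      also have "real (card {1..k} * card (up_pairs n)) = real k * b" by (simp add: card_up_pairs b_def)
      also have "\<dots> \<le> (\<epsilon> / 2 * b)\<^sup>2"
      proof -
        have "4 * real k \<le> b * \<epsilon>\<^sup>2" using r_k mult_right_mono[OF rb, of "\<epsilon>\<^sup>2"] by simp
        then have "4 * real k * b \<le> b * \<epsilon>\<^sup>2 * b" using b0 by (intro mult_right_mono) auto
        then show ?thesis by (simp add: power2_eq_square algebra_simps)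
      qed
      \<comment> \<open>Rounding takes one half of \<open>\<epsilon>\<close>; avoiding
        \<open>bad\<close> costs the other half.\<close>
      finally have "\<bar>real (card (G l)) - S\<bar> \<le> \<epsilon> / 2 * b"
        using b0 \<epsilon> by (simp only: abs_le_square_iff[symmetric]) simp
      moreover have "t_K2 (W {l}) * b - \<epsilon> / 2 * b < S"
        using x(1,3) l by (auto simp: bad_def S_def case_prod_unfold card_up_pairs b_def not_le)
      ultimately show ?thesis unfolding b_def[symmetric] left_diff_distrib by linarith
    qed
    ultimately show ?thesis by blast
  qed
  then show ?thesis by blast
qed

section \<open>The limit\<close>

lemma finite_system_minima:
  fixes n :: nat
  assumes "1 \<le> k"
  shows "finite {Min ((\<lambda>i. card (G i)) ` {1..k}) | G. graph_system k {1..n} G \<and> rainbow_free k {1..n} G H \<psi>}"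
proof (rule finite_subset)
  show "{Min ((\<lambda>i. card (G i)) ` {1..k}) | G. graph_system k {1..n} G \<and> rainbow_free k {1..n} G H \<psi>}
    \<subseteq> {..card (Pow {1..n})}"
  proof clarify
    fix G assume G: "graph_system k {1..n} G"
    have "Min ((\<lambda>i. card (G i)) ` {1..k}) \<le> card (G 1)" using assms by (intro Min_le) auto
    also have "\<dots> \<le> card (Pow {1..n})"
    proof (rule card_mono)
      have "1 \<in> {1..k}" using assms by simp
      then show "G 1 \<subseteq> Pow {1..n}" using G unfolding graph_system_def by blast
    qed simp
    finally show "Min ((\<lambda>i. card (G i)) ` {1..k}) \<le> card (Pow {1..n})" .
  qed
qed simp

lemma ex_star_ge:
  assumes k: "1 \<le> k" and "graph_system k {1..n} G" "rainbow_free k {1..n} G H \<psi>"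
    and bound: "\<And>l. l \<in> {1..k} \<Longrightarrow> c \<le> real (card (G l))"
  shows "c \<le> real (ex_star k n H \<psi>)"
proof -
  have "Min ((\<lambda>i. card (G i)) ` {1..k}) \<in> (\<lambda>i. card (G i)) ` {1..k}" using k by (intro Min_in) auto
  then have "c \<le> real (Min ((\<lambda>i. card (G i)) ` {1..k}))" using bound by auto
  moreover have "Min ((\<lambda>i. card (G i)) ` {1..k}) \<le> ex_star k n H \<psi>"
    unfolding ex_star_def
  proof (rule cSup_upper[OF _ bdd_above_finite[OF finite_system_minima[OF k]]])
    show "Min ((\<lambda>i. card (G i)) ` {1..k}) \<in>
      {Min ((\<lambda>i. card (G i)) ` {1..k}) | G. graph_system k {1..n} G \<and> rainbow_free k {1..n} G H \<psi>}"
      using assms(2,3) by blast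
  qed
  ultimately show ?thesis by linarith
qed

text \<open>Positivity excludes an empty family of free systems, for which the value is 0 by
  convention.\<close>

lemma ex_star_attained:
  assumes k: "1 \<le> k" and "0 < ex_star k n H \<psi>"
  shows "\<exists>G. graph_system k {1..n} G \<and> rainbow_free k {1..n} G H \<psi> \<and> (\<forall>l\<in>{1..k}. ex_star k n H \<psi> \<le> card (G l))"
proof -
  let ?S = "{Min ((\<lambda>i. card (G i)) ` {1..k}) | G. graph_system k {1..n} G \<and> rainbow_free k {1..n} G H \<psi>}"
  have "?S \<noteq> {}" using assms(2) unfolding ex_star_def by (intro notI) (simp only: Sup_nat_empty less_irrefl)
  then have "Sup ?S \<in> ?S" using finite_system_minima[OF k] by (simp only: Sup_nat_def if_False) (rule Max_in)
  then obtain G where "graph_system k {1..n} G" "rainbow_free k {1..n} G H \<psi>"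
    "ex_star k n H \<psi> = Min ((\<lambda>i. card (G i)) ` {1..k})"
    unfolding ex_star_def[symmetric] by auto
  then show ?thesis using Min_le[of "(\<lambda>i. card (G i)) ` {1..k}"] by (intro exI[of _ G]) auto
qed

theorem theorem4p4:
  fixes k :: nat and H :: "('v, 'e) multigraph" and \<psi> :: "'e \<rightharpoonup> nat"
  assumes "k \<ge> 1"
    and "loopless_multigraph H"
    and "rainbow_precoloring k H \<psi>"
  shows "convergent (ex_density k H \<psi>) \<and>
    ennreal (pi_star k H \<psi>) =
      (SUP W\<in>{W. admissible k W \<and> t_star k H \<psi> W = 0}.
         ennreal (Min ((\<lambda>l. t_K2 (W {l})) ` {1..k})))"
proof -
  define A where "A = {W. admissible k W \<and> t_star k H \<psi> W = 0}"
  define v where "v W = Min ((\<lambda>l. t_K2 (W {l})) ` {1..k})" for W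
  \<comment> \<open>The family \<open>A\<close> is empty when \<open>H\<close> has no edges.
    Inserting 0 gives the real supremum the value that \<open>SUP\<close> has there in
    \<open>ennreal\<close>, whose least element is 0.\<close>
  define s where "s = Sup (insert 0 (v ` A))"
  have v_le_1: "v W \<le> 1" if "W \<in> A" for W
  proof -
    have "graphon (W {1})" using that assms(1) by (auto simp: A_def admissible_def graphon_system_def)
    then have "t_K2 (W {1}) \<le> 1"
      unfolding t_K2_def
      by (intro unit_square.P.integral_le_const unit_square.P.integrable_const_bound[of _ 1] AE_I2)
        (auto simp: graphon_def space_unit_square)
    moreover have "v W \<le> t_K2 (W {1})" unfolding v_def using assms(1) by (intro Min_le) auto
    ultimately show ?thesis by simp
  qed
  have bdd: "bdd_above (insert 0 (v ` A))" using v_le_1 by (auto intro!: bdd_aboveI[of _ 1])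
  have s0: "0 \<le> s" unfolding s_def by (rule cSup_upper[OF _ bdd]) simp
  have s_upper: "v W \<le> s" if "W \<in> A" for W unfolding s_def by (rule cSup_upper[OF _ bdd]) (use that in simp)
  have SUP: "(SUP W\<in>A. ennreal (v W)) = ennreal s"
  proof (rule antisym)
    show "(SUP W\<in>A. ennreal (v W)) \<le> ennreal s" by (intro SUP_least ennreal_leI s_upper)
    have "(SUP W\<in>A. ennreal (v W)) \<le> 1" using v_le_1 by (intro SUP_least) (simp add: ennreal_le_1)
    then have "(SUP W\<in>A. ennreal (v W)) < top" by (rule le_less_trans) simp
    then obtain r where r: "(SUP W\<in>A. ennreal (v W)) = ennreal r" "0 \<le> r"
      unfolding less_top_ennreal by blast
    have "v W \<le> r" if "W \<in> A" for W
      using SUP_upper[OF that, of "\<lambda>W. ennreal (v W)"] r by (simp add: ennreal_le_iff)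
    then have "s \<le> r" unfolding s_def using r(2) by (intro cSup_least) auto
    then show "ennreal s \<le> (SUP W\<in>A. ennreal (v W))" unfolding r(1) by (rule ennreal_leI)
  qed
  have "ex_density k H \<psi> \<longlonglongrightarrow> s"
  proof (rule LIMSEQ_I)
    fix \<epsilon> :: real assume \<epsilon>: "0 < \<epsilon>"
    have lower: "\<exists>n1. \<forall>n\<ge>n1. s - \<epsilon> < ex_density k H \<psi> n"
    proof -
      have "s - \<epsilon> / 2 < Sup (insert 0 (v ` A))" using \<epsilon> by (simp add: s_def)
      then obtain y where y: "y \<in> insert 0 (v ` A)" "s - \<epsilon> / 2 < y"
        using less_cSupE[of "s - \<epsilon> / 2" "insert 0 (v ` A)"] by blast
      show ?thesis
      \<comment> \<open>If the near-maximal value is the inserted 0, there is no graphon system to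
        sample from, but nonnegativity of the densities is enough.\<close>
      proof (cases "y = 0")
        case True
        have "0 \<le> ex_density k H \<psi> n" for n by (simp add: ex_density_def)
        moreover have "s - \<epsilon> < 0" using True y(2) \<epsilon> by linarith
        ultimately show ?thesis by (intro exI[of _ 0]) (metis less_le_trans)
      next
        case False
        then obtain W where W: "W \<in> A" "y = v W" using y by auto
        obtain n0 where n0: "\<And>n. n0 \<le> n \<Longrightarrow> \<exists>G. graph_system k {1..n} G \<and> rainbow_free k {1..n} G H \<psi> \<and>
            (\<forall>l\<in>{1..k}. (t_K2 (W {l}) - \<epsilon> / 2) * real (n choose 2) \<le> real (card (G l)))"
          using graphon_free_systems[OF assms(2,3), of W "\<epsilon> / 2"] W \<epsilon> unfolding A_def by auto
        have "s - \<epsilon> < ex_density k H \<psi> n" if n: "max n0 2 \<le> n" for n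
        proof -
          obtain G where G: "graph_system k {1..n} G" "rainbow_free k {1..n} G H \<psi>"
            "\<forall>l\<in>{1..k}. (t_K2 (W {l}) - \<epsilon> / 2) * real (n choose 2) \<le> real (card (G l))"
            using n0[of n] n by auto
          have "(v W - \<epsilon> / 2) * real (n choose 2) \<le> real (ex_star k n H \<psi>)"
          proof (rule ex_star_ge[OF assms(1) G(1,2)])
            fix l assume l: "l \<in> {1..k}"
            have "v W \<le> t_K2 (W {l})" unfolding v_def using l by (intro Min_le) auto
            then have "(v W - \<epsilon> / 2) * real (n choose 2) \<le> (t_K2 (W {l}) - \<epsilon> / 2) * real (n choose 2)"
              by (intro mult_right_mono) auto
            then show "(v W - \<epsilon> / 2) * real (n choose 2) \<le> real (card (G l))" using G(3) l by fastforce
          qed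
          moreover have "0 < real (n choose 2)" using n by simp
          ultimately have "v W - \<epsilon> / 2 \<le> ex_density k H \<psi> n"
            by (simp add: ex_density_def pos_le_divide_eq)
          then show ?thesis using y(2) W(2) by linarith
        qed
        then show ?thesis by blast
      qed
    qed
    have upper: "\<exists>n2. \<forall>n\<ge>n2. ex_density k H \<psi> n < s + \<epsilon>"
    proof -
      have "Min ((\<lambda>l. t_K2 (W {l})) ` {1..k}) \<le> s" if "admissible k W" "t_star k H \<psi> W = 0" for W
        using s_upper[of W] that by (simp add: A_def v_def)
      then obtain n0 where n0: "\<And>n G. n0 \<le> n \<Longrightarrow> graph_system k {1..n} G \<Longrightarrow> rainbow_free k {1..n} G H \<psi> \<Longrightarrow>
          \<exists>l\<in>{1..k}. real (card (G l)) \<le> (s + \<epsilon> / 2) * real (n choose 2)"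
        using dense_systems_not_free[OF assms s0, of "\<epsilon> / 2"] half_gt_zero[OF \<epsilon>] by meson
      have "ex_density k H \<psi> n < s + \<epsilon>" if n: "max n0 2 \<le> n" for n
      \<comment> \<open>The value 0 may mean that no free system exists, so it is treated apart from
        the attained values.\<close>
      proof (cases "ex_star k n H \<psi> = 0")
        case True
        then show ?thesis using s0 \<epsilon> by (simp add: ex_density_def)
      next
        case False
        then obtain G where G: "graph_system k {1..n} G" "rainbow_free k {1..n} G H \<psi>"
          "\<forall>l\<in>{1..k}. ex_star k n H \<psi> \<le> card (G l)"
          using ex_star_attained[OF assms(1), of n H \<psi>] by auto
        obtain l where l: "l \<in> {1..k}" "real (card (G l)) \<le> (s + \<epsilon> / 2) * real (n choose 2)"
          using n0[OF _ G(1,2)] n by auto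
        have "real (ex_star k n H \<psi>) \<le> real (card (G l))" using G(3) l(1) by simp
        then have "real (ex_star k n H \<psi>) \<le> (s + \<epsilon> / 2) * real (n choose 2)" using l(2) by linarith
        moreover have "0 < real (n choose 2)" using n by simp
        ultimately have "ex_density k H \<psi> n \<le> s + \<epsilon> / 2"
          by (simp add: ex_density_def pos_divide_le_eq)
        then show ?thesis using \<epsilon> by linarith
      qed
      then show ?thesis by blast
    qed
    obtain n1 n2 where "\<And>n. n1 \<le> n \<Longrightarrow> s - \<epsilon> < ex_density k H \<psi> n" "\<And>n. n2 \<le> n \<Longrightarrow> ex_density k H \<psi> n < s + \<epsilon>"
      using lower upper by blast
    then show "\<exists>n0. \<forall>n\<ge>n0. norm (ex_density k H \<psi> n - s) < \<epsilon>"
      by (intro exI[of _ "max n1 n2"]) (auto simp: abs_less_iff algebra_simps)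
  qed
  then have "convergent (ex_density k H \<psi>)" "pi_star k H \<psi> = s"
    by (auto simp: convergent_def pi_star_def limI)
  then show ?thesis using SUP by (simp add: A_def v_def)
qed

end
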